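(* Let $G=\langle a,b,c,d\rangle$ be the first Grigorchuk group and $G'=[G,G]$. Then: (1) every element of $G'$ is a product of $6$ conjugates (in $G$) of the generator $a$; (2) there are elements $g\in G'$ which are not products of $4$ conjugates of $a$; (3) every element of $G$ is a product of at most $8$ conjugates of the standard generators $\{a,b,c,d\}$.
   Context: An automorphism $g$ of the rooted binary tree $T_2$ is identified with $\langle\!\langle g_1,g_2\rangle\!\rangle\sigma\in \mathrm{Aut}(T_2)\wr S_2$, where $\sigma\in S_2$ is its action on the two subtrees below the root and $g_1,g_2\in\mathrm{Aut}(T_2)$ are its states; multiplication is $\langle\!\langle g_1,g_2\rangle\!\rangle\sigma\cdot\langle\!\langle h_1,h_2\rangle\!\rangle\tau=\langle\!\langle g_1h_{1^\sigma},g_2h_{2^\sigma}\rangle\!\rangle\sigma\tau$. The first Grigorchuk group $G$ is the subgroup of $\mathrm{Aut}(T_2)$ generated by $a,b,c,d$, defined recursively by $a=\langle\!\langle 1,1\rangle\!\rangle(1,2)$, $b=\langle\!\langle a,c\rangle\!\rangle$, $c=\langle\!\langle a,d\rangle\!\rangle$, $d=\langle\!\langle 1,b\rangle\!\rangle$. *)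

theory Defs
  imports "HOL-Algebra.Generated_Groups"
begin

section \<open>The automorphism group of the rooted binary tree\<close>

text \<open>Vertices are finite words over a two-letter alphabet, the root being the empty word;
  \<^term>\<open>False\<close> and \<^term>\<open>True\<close> are the letters 1 and 2.\<close>

type_synonym vertex = "bool list"

definition child :: "vertex \<Rightarrow> vertex \<Rightarrow> bool" where
  "child u v \<longleftrightarrow> (\<exists>x. v = u @ [x])"

text \<open>Automorphisms act from the right, so the product \<open>g h\<close> applies \<open>g\<close> first.\<close>

definition Aut_T2 :: "(vertex \<Rightarrow> vertex) monoid" where
  "Aut_T2 = \<lparr>carrier = {g. bij g \<and> g [] = [] \<and> (\<forall>u v. child (g u) (g v) \<longleftrightarrow> child u v)},
             mult = (\<lambda>g h. h \<circ> g),
             one = id\<rparr>"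

text \<open>The automorphism with states \<open>g1\<close>, \<open>g2\<close> and root action \<open>\<sigma>\<close>.\<close>

fun wr :: "(vertex \<Rightarrow> vertex) \<Rightarrow> (vertex \<Rightarrow> vertex) \<Rightarrow> (bool \<Rightarrow> bool) \<Rightarrow> vertex \<Rightarrow> vertex" where
  "wr g1 g2 \<sigma> [] = []"
| "wr g1 g2 \<sigma> (x # w) = \<sigma> x # (if x then g2 w else g1 w)"

lemma wr_mult:
  "wr g1 g2 \<sigma> \<otimes>\<^bsub>Aut_T2\<^esub> wr h1 h2 \<tau> =
   wr (g1 \<otimes>\<^bsub>Aut_T2\<^esub> (if \<sigma> False then h2 else h1)) (g2 \<otimes>\<^bsub>Aut_T2\<^esub> (if \<sigma> True then h2 else h1))
      (\<tau> \<circ> \<sigma>)"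
proof
  show "(wr g1 g2 \<sigma> \<otimes>\<^bsub>Aut_T2\<^esub> wr h1 h2 \<tau>) w =
   wr (g1 \<otimes>\<^bsub>Aut_T2\<^esub> (if \<sigma> False then h2 else h1)) (g2 \<otimes>\<^bsub>Aut_T2\<^esub> (if \<sigma> True then h2 else h1))
      (\<tau> \<circ> \<sigma>) w" for w
    by (cases w) (auto simp: Aut_T2_def)
qed

lemma group_Aut_T2: "group Aut_T2"
proof (rule groupI)
  fix g assume g: "g \<in> carrier Aut_T2"
  then have b: "bij g" and r: "g [] = []" and c: "\<And>u v. child (g u) (g v) \<longleftrightarrow> child u v"
    by (auto simp: Aut_T2_def)
  have "child (inv_into UNIV g u) (inv_into UNIV g v) \<longleftrightarrow> child u v" for u v
    using c[of "inv_into UNIV g u" "inv_into UNIV g v"] b by (simp add: bij_is_surj surj_f_inv_f)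
  moreover have "inv_into UNIV g [] = []"
    using r bij_inv_eq_iff[OF b, of "[]" "[]"] by simp
  moreover have "g \<circ> inv_into UNIV g = id"
    using bij_is_surj[OF b] by (simp only: surj_iff)
  ultimately show "\<exists>h\<in>carrier Aut_T2. h \<otimes>\<^bsub>Aut_T2\<^esub> g = \<one>\<^bsub>Aut_T2\<^esub>"
    using b by (intro bexI[of _ "inv_into UNIV g"]) (auto simp: Aut_T2_def bij_imp_bij_inv)
qed (auto simp: Aut_T2_def bij_comp comp_assoc)

lemma child_simps [simp]:
  "\<not> child u []" "child [] (x # v) \<longleftrightarrow> v = []" "child (x # u) (y # v) \<longleftrightarrow> x = y \<and> child u v"
  by (auto simp: child_def)

lemma wr_in_Aut_T2:
  assumes "g1 \<in> carrier Aut_T2" "g2 \<in> carrier Aut_T2" "bij \<sigma>"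
  shows "wr g1 g2 \<sigma> \<in> carrier Aut_T2"
proof -
  have b: "bij g1" "bij g2" and r: "g1 [] = []" "g2 [] = []"
    and c: "\<And>u v. child (g1 u) (g1 v) \<longleftrightarrow> child u v" "\<And>u v. child (g2 u) (g2 v) \<longleftrightarrow> child u v"
    using assms by (auto simp: Aut_T2_def)
  have e: "g1 v = [] \<longleftrightarrow> v = []" "g2 v = [] \<longleftrightarrow> v = []" for v
    using r inj_eq[OF bij_is_inj[OF b(1)], of v "[]"] inj_eq[OF bij_is_inj[OF b(2)], of v "[]"]
    by simp_all
  have s: "\<sigma> x = \<sigma> y \<longleftrightarrow> x = y" for x y
    using \<open>bij \<sigma>\<close> by (intro inj_eq bij_is_inj)
  have i: "g1 u = g1 v \<longleftrightarrow> u = v" "g2 u = g2 v \<longleftrightarrow> u = v" for u v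
    using b by (auto intro!: inj_eq bij_is_inj)
  have "inj (wr g1 g2 \<sigma>)"
  proof (rule injI)
    fix u v assume "wr g1 g2 \<sigma> u = wr g1 g2 \<sigma> v"
    then show "u = v"
      by (cases u; cases v) (auto simp: s i split: if_splits)
  qed
  moreover have "\<exists>u. v = wr g1 g2 \<sigma> u" for v
  proof (cases v)
    case Nil
    then show ?thesis by (intro exI[of _ "[]"]) simp
  next
    case (Cons y w)
    obtain x where x: "y = \<sigma> x" using bij_is_surj[OF \<open>bij \<sigma>\<close>] by (rule surjE)
    obtain w1 where "w = g1 w1" using bij_is_surj[OF b(1)] by (rule surjE)
    moreover obtain w2 where "w = g2 w2" using bij_is_surj[OF b(2)] by (rule surjE)
    ultimately show ?thesis
      using Cons x by (intro exI[of _ "x # (if x then w2 else w1)"]) auto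
  qed
  moreover have "child (wr g1 g2 \<sigma> u) (wr g1 g2 \<sigma> v) \<longleftrightarrow> child u v" for u v
    by (cases u; cases v) (auto simp: s e c)
  ultimately show ?thesis
    by (auto simp: Aut_T2_def bij_def surj_def)
qed


section \<open>The first Grigorchuk group\<close>

definition gen_a :: "vertex \<Rightarrow> vertex" where
  "gen_a = wr id id Not"

text \<open>The following equations spell out
  \<open>b = \<langle>\<langle>a, c\<rangle>\<rangle>\<close>, \<open>c = \<langle>\<langle>a, d\<rangle>\<rangle>\<close>, \<open>d = \<langle>\<langle>1, b\<rangle>\<rangle>\<close>; see the lemmas below.\<close>

fun gen_b :: "vertex \<Rightarrow> vertex" and gen_c :: "vertex \<Rightarrow> vertex" and gen_d :: "vertex \<Rightarrow> vertex" where
  "gen_b [] = []"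
| "gen_b (x # w) = x # (if x then gen_c w else gen_a w)"
| "gen_c [] = []"
| "gen_c (x # w) = x # (if x then gen_d w else gen_a w)"
| "gen_d [] = []"
| "gen_d (x # w) = x # (if x then gen_b w else w)"

lemma gen_b_wr: "gen_b = wr gen_a gen_c id"
proof
  show "gen_b w = wr gen_a gen_c id w" for w by (cases w) auto
qed

lemma gen_c_wr: "gen_c = wr gen_a gen_d id"
proof
  show "gen_c w = wr gen_a gen_d id w" for w by (cases w) auto
qed

lemma gen_d_wr: "gen_d = wr id gen_b id"
proof
  show "gen_d w = wr id gen_b id w" for w by (cases w) auto
qed

definition grigorchuk :: "(vertex \<Rightarrow> vertex) monoid" where
  "grigorchuk = Aut_T2\<lparr>carrier := generate Aut_T2 {gen_a, gen_b, gen_c, gen_d}\<rparr>"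

lemma gen_a_in_Aut_T2: "gen_a \<in> carrier Aut_T2"
proof -
  have "id \<in> carrier Aut_T2" by (simp add: Aut_T2_def)
  moreover have "bij Not" by (rule involuntory_imp_bij) simp
  ultimately show ?thesis unfolding gen_a_def by (intro wr_in_Aut_T2)
qed

lemma gen_involution:
  "gen_a (gen_a w) = w" "gen_b (gen_b w) = w" "gen_c (gen_c w) = w" "gen_d (gen_d w) = w"
proof -
  show a: "gen_a (gen_a w) = w" for w by (cases w) (auto simp: gen_a_def)
  show "gen_b (gen_b w) = w" "gen_c (gen_c w) = w" "gen_d (gen_d w) = w"
    by (induction w and w and w rule: gen_b_gen_c_gen_d.induct) (auto simp: a)
qed

lemma gen_child:
  "child (gen_b u) (gen_b v) \<longleftrightarrow> child u v"
  "child (gen_c u) (gen_c v) \<longleftrightarrow> child u v"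
  "child (gen_d u) (gen_d v) \<longleftrightarrow> child u v"
proof -
  have a: "child (gen_a u) (gen_a v) \<longleftrightarrow> child u v" for u v
    using gen_a_in_Aut_T2 by (simp add: Aut_T2_def)
  have nil: "gen_a v = [] \<longleftrightarrow> v = []" "gen_b v = [] \<longleftrightarrow> v = []" "gen_c v = [] \<longleftrightarrow> v = []"
    "gen_d v = [] \<longleftrightarrow> v = []" for v
    by (cases v; simp add: gen_a_def)+
  have "(child (gen_b u) (gen_b v) \<longleftrightarrow> child u v) \<and> (child (gen_c u) (gen_c v) \<longleftrightarrow> child u v) \<and>
    (child (gen_d u) (gen_d v) \<longleftrightarrow> child u v)"
  proof (induction u arbitrary: v)
    case Nil
    then show ?case by (cases v) (auto simp: nil)
  next
    case (Cons x u)
    then show ?case by (cases v) (auto simp: a)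
  qed
  then show "child (gen_b u) (gen_b v) \<longleftrightarrow> child u v" "child (gen_c u) (gen_c v) \<longleftrightarrow> child u v"
    "child (gen_d u) (gen_d v) \<longleftrightarrow> child u v" by auto
qed

lemma gens_in_Aut_T2: "{gen_a, gen_b, gen_c, gen_d} \<subseteq> carrier Aut_T2"
proof -
  have "bij gen_b" "bij gen_c" "bij gen_d"
    by (rule involuntory_imp_bij; simp add: gen_involution)+
  then show ?thesis
    using gen_a_in_Aut_T2 by (auto simp: Aut_T2_def gen_child)
qed

lemma group_grigorchuk: "group grigorchuk"
  unfolding grigorchuk_def
  by (intro group.subgroup_imp_group group_Aut_T2 group.generate_is_subgroup gens_in_Aut_T2)


section \<open>Products of conjugates\<close>

definition conjugates :: "('a, 'b) monoid_scheme \<Rightarrow> 'a set \<Rightarrow> 'a set" where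
  "conjugates G S = {inv\<^bsub>G\<^esub> h \<otimes>\<^bsub>G\<^esub> s \<otimes>\<^bsub>G\<^esub> h | h s. h \<in> carrier G \<and> s \<in> S}"

definition products :: "('a, 'b) monoid_scheme \<Rightarrow> nat \<Rightarrow> 'a set \<Rightarrow> 'a set" where
  "products G n C = {foldr (\<otimes>\<^bsub>G\<^esub>) xs \<one>\<^bsub>G\<^esub> | xs. length xs = n \<and> set xs \<subseteq> C}"

end

(* A conjugate of a is <<x, x^-1>>(1,2), where x runs through a subgroup R of index 2 of G. Hence
   <<g,h>> is a product of 2n conjugates of a as soon as g^-1 h^-1 is a product of n - 1 commutators
   of elements of R, and (1) amounts to solving [p,q][r,s] = h over R for every h in K, the normal
   closure of (ab)^2.  Prescribe the classes of p, q, r, s modulo K.  If p moves the first level and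
   q, r, s fix it, comparing states turns the equation into one with three commutators and right
   hand side h2^x h1, where h = <<h1,h2>>; if all four fix the first level it splits into one
   equation for h1 and one for h2.  Mapping class group moves bring the classes occurring in three
   commutators to a form where the last pair lies in K, and that pair can be chosen trivial, so
   that two commutators remain.  Finitely many systems of classes are closed under this reduction,
   which can be made to shorten a cyclic word representing h.  In (2), an element <<1,k>> is a
   product of four conjugates of a only if k is a single commutator of elements of R, and this is
   excluded modulo the fourth direct power of K.  Finally (3) follows from (1), because G/G' is
   represented by products of at most two generators. *)

theory Submission
  imports Defs "HOL-Library.Product_Plus"
begin

section \<open>The group of bijections of the tree, written additively\<close>

text \<open>Two difficulties shape the argument. First, which systems can be prescribed for h2^x h1
  depends on the class of that element, which the class of h modulo K does not determine. Hence the
  finer quotient G/M, and hence the free conjugator x, taken from 1, a and b, which steers h2^x h1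
  into a suitable class. For h in K outside M one can stay outside M, and the systems (a,b,b,c) and
  (a,b,1,c) reduce to each other, so a single induction carries both. For h in M the states range
  over the classes of 1, (a b)^2, (a c)^2 and (a d)^2 modulo M, and these call for further systems.
  Second, h2 h1 may be as long as h, and conjugation by b even adds letters. Outside M, rotating the
  cyclic word makes letters merge or cancel; only certain powers of a b resist, and they are single
  commutators. In M the gain comes from the system (1,1,1,b), which splits into separate equations
  for the two states, both shorter than h once its word is alternating.\<close>

text \<open>Additive notation makes the simplification rules of the class \<open>group_add\<close>, whose addition
  need not commute, available for computing with products, conjugates and commutators.\<close>

typedef tperm = "{f :: vertex \<Rightarrow> vertex. bij f}"
  by (intro exI[of _ id]) simp

instantiation tperm :: group_add
begin

definition zero_tperm :: tperm where "0 = Abs_tperm id"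
definition plus_tperm :: "tperm \<Rightarrow> tperm \<Rightarrow> tperm" where
  "x + y = Abs_tperm (Rep_tperm y \<circ> Rep_tperm x)"
definition uminus_tperm :: "tperm \<Rightarrow> tperm" where
  "- x = Abs_tperm (inv_into UNIV (Rep_tperm x))"
definition minus_tperm :: "tperm \<Rightarrow> tperm \<Rightarrow> tperm" where
  "x - y = x + (- y :: tperm)"

lemma bij_Rep_tperm: "bij (Rep_tperm x)"
  using Rep_tperm[of x] by simp

lemma Rep_zero: "Rep_tperm 0 = id"
  by (simp add: zero_tperm_def Abs_tperm_inverse)

lemma Rep_plus: "Rep_tperm (x + y) = Rep_tperm y \<circ> Rep_tperm x"
  by (simp add: plus_tperm_def Abs_tperm_inverse bij_Rep_tperm bij_comp)

lemma Rep_uminus: "Rep_tperm (- x) = inv_into UNIV (Rep_tperm x)"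
  by (simp add: uminus_tperm_def Abs_tperm_inverse bij_Rep_tperm bij_imp_bij_inv)

instance
proof
  fix x y z :: tperm
  show "x + y + z = x + (y + z)"
    by (simp add: Rep_tperm_inject[symmetric] Rep_plus comp_assoc)
  show "0 + x = x" "x + 0 = x"
    by (simp_all add: Rep_tperm_inject[symmetric] Rep_plus Rep_zero)
  show "- x + x = 0"
    using bij_is_surj[OF bij_Rep_tperm[of x]]
    by (simp add: Rep_tperm_inject[symmetric] Rep_plus Rep_zero Rep_uminus surj_iff)
  show "x + - y = x - y" by (simp add: minus_tperm_def)
qed

end

section \<open>Wreath decomposition in the group of tree bijections\<close>

lemma bij_wr:
  assumes "bij g" "bij h" "bij s"
  shows "bij (wr g h s)"
proof -
  have s: "s x = s y \<longleftrightarrow> x = y" for x y using assms(3) by (intro inj_eq bij_is_inj)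
  have i: "g u = g v \<longleftrightarrow> u = v" "h u = h v \<longleftrightarrow> u = v" for u v
    using assms by (auto intro!: inj_eq bij_is_inj)
  have "inj (wr g h s)"
  proof (rule injI)
    fix u v assume "wr g h s u = wr g h s v"
    then show "u = v" by (cases u; cases v) (auto simp: s i split: if_splits)
  qed
  moreover have "\<exists>u. v = wr g h s u" for v
  proof (cases v)
    case Nil
    then show ?thesis by (intro exI[of _ "[]"]) simp
  next
    case (Cons y w)
    obtain x where "y = s x" using bij_is_surj[OF assms(3)] by (rule surjE)
    moreover obtain u where "w = g u" using bij_is_surj[OF assms(1)] by (rule surjE)
    moreover obtain v where "w = h v" using bij_is_surj[OF assms(2)] by (rule surjE)
    ultimately show ?thesis using Cons by (intro exI[of _ "x # (if x then v else u)"]) auto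
  qed
  ultimately show ?thesis by (auto simp: bij_def surj_def)
qed

definition wre :: "tperm \<Rightarrow> tperm \<Rightarrow> bool \<Rightarrow> tperm" where
  "wre x y s = Abs_tperm (wr (Rep_tperm x) (Rep_tperm y) (if s then Not else id))"

lemma bij_Not: "bij Not"
  by (rule involuntory_imp_bij) simp

lemma Rep_wre: "Rep_tperm (wre x y s) = wr (Rep_tperm x) (Rep_tperm y) (if s then Not else id)"
  by (simp add: wre_def Abs_tperm_inverse bij_wr bij_Rep_tperm bij_Not)

lemma wre_add:
  "wre x y s + wre x' y' s' =
   wre (x + (if s then y' else x')) (y + (if s then x' else y')) (s \<noteq> s')"
proof -
  have "Rep_tperm (wre x y s + wre x' y' s') w =
    Rep_tperm (wre (x + (if s then y' else x')) (y + (if s then x' else y')) (s \<noteq> s')) w" for w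
    by (cases w) (auto simp: Rep_plus Rep_wre)
  then show ?thesis by (simp add: Rep_tperm_inject[symmetric] fun_eq_iff)
qed

lemma wre_0: "wre 0 0 False = 0"
proof -
  have "Rep_tperm (wre 0 0 False) w = w" for w by (cases w) (auto simp: Rep_wre Rep_zero)
  then show ?thesis by (simp add: Rep_tperm_inject[symmetric] fun_eq_iff Rep_zero)
qed

lemma wre_inject: "wre x y s = wre x' y' s' \<longleftrightarrow> x = x' \<and> y = y' \<and> s = s'"
proof
  assume eq: "wre x y s = wre x' y' s'"
  have r: "Rep_tperm (wre x y s) w = Rep_tperm (wre x' y' s') w" for w by (simp add: eq)
  have "Rep_tperm x w = Rep_tperm x' w" "Rep_tperm y w = Rep_tperm y' w" for w
    using r[of "False # w"] r[of "True # w"] by (auto simp: Rep_wre split: if_splits)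
  moreover have "s = s'" using r[of "[False]"] by (auto simp: Rep_wre split: if_splits)
  ultimately show "x = x' \<and> y = y' \<and> s = s'"
    by (simp add: Rep_tperm_inject[symmetric] fun_eq_iff)
qed simp

lemma wre_uminus: "- wre x y s = (if s then wre (- y) (- x) True else wre (- x) (- y) False)"
  by (rule minus_unique) (simp add: wre_add wre_0)


section \<open>Words and their classes\<close>

datatype gen = GA | GB | GC | GD

type_synonym word = "gen list"

text \<open>\<open>G/K\<close> has order 16 and \<open>G/M\<close> order 32; in both quotients the element
  \<open>a\<^sup>i b\<^sup>j d\<^sup>k [b,a]\<^sup>m [d,a]\<^sup>n\<close> is represented by its exponents modulo 2.
  The subgroup \<open>K\<close> is the normal closure of \<open>(a b)\<^sup>2\<close>, and \<open>M\<close> has index 2 in \<open>K\<close>.\<close>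

datatype cls = Cls (ci: bool) (cj: bool) (ck: bool) (cm: bool) (cn: bool)
datatype kls = Kls (ki: bool) (kj: bool) (kk: bool) (kn: bool)

instantiation cls :: group_add
begin
definition zero_cls :: cls where "0 = Cls False False False False False"
fun plus_cls :: "cls \<Rightarrow> cls \<Rightarrow> cls" where
  "Cls i j k m n + Cls i' j' k' m' n' =
   Cls (i \<noteq> i') (j \<noteq> j') (k \<noteq> k') ((m \<noteq> m') \<noteq> (j \<and> i')) ((n \<noteq> n') \<noteq> (k \<and> i'))"
fun uminus_cls :: "cls \<Rightarrow> cls" where
  "- Cls i j k m n = Cls i j k (m \<noteq> (j \<and> i)) (n \<noteq> (k \<and> i))"
definition minus_cls :: "cls \<Rightarrow> cls \<Rightarrow> cls" where "x - y = x + (- y :: cls)"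
instance
proof
  fix x y z :: cls
  show "x + y + z = x + (y + z)" by (cases x; cases y; cases z) auto
  show "0 + x = x" "x + 0 = x" "- x + x = 0" by (cases x; auto simp: zero_cls_def)+
  show "x + - y = x - y" by (simp add: minus_cls_def)
qed
end

instantiation kls :: group_add
begin
definition zero_kls :: kls where "0 = Kls False False False False"
fun plus_kls :: "kls \<Rightarrow> kls \<Rightarrow> kls" where
  "Kls i j k n + Kls i' j' k' n' = Kls (i \<noteq> i') (j \<noteq> j') (k \<noteq> k') ((n \<noteq> n') \<noteq> (k \<and> i'))"
fun uminus_kls :: "kls \<Rightarrow> kls" where
  "- Kls i j k n = Kls i j k (n \<noteq> (k \<and> i))"
definition minus_kls :: "kls \<Rightarrow> kls \<Rightarrow> kls" where "x - y = x + (- y :: kls)"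
instance
proof
  fix x y z :: kls
  show "x + y + z = x + (y + z)" by (cases x; cases y; cases z) auto
  show "0 + x = x" "x + 0 = x" "- x + x = 0" by (cases x; auto simp: zero_kls_def)+
  show "x + - y = x - y" by (simp add: minus_kls_def)
qed
end

lemma minus_Kls [simp]:
  "Kls i j k n - Kls i' j' k' n' =
   Kls (i \<noteq> i') (j \<noteq> j') (k \<noteq> k') ((n \<noteq> (n' \<noteq> (k' \<and> i'))) \<noteq> (k \<and> i'))"
  by (simp only: minus_kls_def uminus_kls.simps plus_kls.simps)

fun kof :: "cls \<Rightarrow> kls" where "kof (Cls i j k m n) = Kls i j k n"

lemma kof_hom: "kof (x + y) = kof x + kof y" "kof 0 = 0" "kof (- x) = - kof x"
  by (cases x; cases y; simp add: zero_cls_def zero_kls_def)+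

fun gclass :: "gen \<Rightarrow> cls" where
  "gclass GA = Cls True False False False False"
| "gclass GB = Cls False True False False False"
| "gclass GC = Cls False True True False False"
| "gclass GD = Cls False False True False False"

fun gperm :: "gen \<Rightarrow> tperm" where
  "gperm GA = Abs_tperm gen_a"
| "gperm GB = Abs_tperm gen_b"
| "gperm GC = Abs_tperm gen_c"
| "gperm GD = Abs_tperm gen_d"

fun gfun :: "gen \<Rightarrow> vertex \<Rightarrow> vertex" where
  "gfun GA = gen_a" | "gfun GB = gen_b" | "gfun GC = gen_c" | "gfun GD = gen_d"

lemma Rep_gperm: "Rep_tperm (gperm x) = gfun x"
  using gens_in_Aut_T2 by (cases x) (auto simp: Aut_T2_def Abs_tperm_inverse)

lemma gperm_wre:
  "gperm GA = wre 0 0 True" "gperm GB = wre (gperm GA) (gperm GC) False"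
  "gperm GC = wre (gperm GA) (gperm GD) False" "gperm GD = wre 0 (gperm GB) False"
  unfolding Rep_tperm_inject[symmetric] Rep_wre Rep_gperm Rep_zero
  by (simp_all only: gfun.simps if_True if_False gen_a_def[symmetric]
      gen_b_wr[symmetric] gen_c_wr[symmetric] gen_d_wr[symmetric])

declare gperm.simps [simp del]

definition E :: "word \<Rightarrow> tperm" where "E w = sum_list (map gperm w)"
definition cl :: "word \<Rightarrow> cls" where "cl w = sum_list (map gclass w)"
definition kl :: "word \<Rightarrow> kls" where "kl w = kof (cl w)"

lemma E_simps [simp]: "E [] = 0" "E (x # w) = gperm x + E w" "E (u @ v) = E u + E v"
  by (simp_all add: E_def)

lemma cl_simps [simp]: "cl [] = 0" "cl (x # w) = gclass x + cl w" "cl (u @ v) = cl u + cl v"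
  by (simp_all add: cl_def)

lemma kl_simps [simp]:
  "kl [] = 0" "kl (x # w) = kof (gclass x) + kl w" "kl (u @ v) = kl u + kl v"
  by (simp_all add: kl_def kof_hom)

lemma gperm_involution [simp]: "- gperm x = gperm x"
proof -
  have "gfun x (gfun x v) = v" for v by (cases x) (simp_all add: gen_involution)
  then have "Rep_tperm (gperm x + gperm x) = id"
    by (simp add: Rep_plus Rep_gperm fun_eq_iff)
  then have "gperm x + gperm x = 0" by (simp add: Rep_tperm_inject[symmetric] Rep_zero)
  then show ?thesis by (rule minus_unique)
qed

lemma gclass_involution [simp]: "- gclass x = gclass x"
  by (cases x) simp_all

lemma E_rev [simp]: "E (rev w) = - E w"
  by (induction w) (simp_all add: minus_add)

lemma cl_rev [simp]: "cl (rev w) = - cl w"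
  by (induction w) (simp_all add: minus_add)

lemma kl_rev [simp]: "kl (rev w) = - kl w"
  by (simp add: kl_def kof_hom)

text \<open>States are kept as words, because weights and classes are read off words. The value
  \<open>False\<close> selects the first state.\<close>

fun st :: "word \<Rightarrow> bool \<Rightarrow> word" where
  "st [] i = []"
| "st (GA # w) i = st w (\<not> i)"
| "st (GB # w) i = (if i then GC else GA) # st w i"
| "st (GC # w) i = (if i then GD else GA) # st w i"
| "st (GD # w) i = (if i then GB # st w i else st w i)"

fun active :: "word \<Rightarrow> bool" where
  "active [] = False"
| "active (x # w) = ((x = GA) \<noteq> active w)"

lemma active_cl: "active w \<longleftrightarrow> ci (cl w)"
proof (induction w)
  case Nil then show ?case by (simp add: zero_cls_def)
next
  case (Cons x w) then show ?case by (cases x; cases "cl w") auto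
qed

lemma active_append [simp]: "active (u @ v) \<longleftrightarrow> active u \<noteq> active v"
  by (induction u) auto

lemma st_append [simp]: "st (u @ v) i = st u i @ st v (i \<noteq> active u)"
  by (induction u i rule: st.induct) auto

lemma E_st: "E w = wre (E (st w False)) (E (st w True)) (active w)"
proof (induction w)
  case Nil then show ?case by (simp add: wre_0)
next
  case (Cons x w)
  have "E (x # w) = gperm x + wre (E (st w False)) (E (st w True)) (active w)"
    using Cons by simp
  also have "\<dots> = wre (E (st (x # w) False)) (E (st (x # w) True)) (active (x # w))"
  proof (cases x)
    case GA then show ?thesis by (simp only: gperm_wre(1) wre_add) simp
  next
    case GB then show ?thesis by (simp only: gperm_wre(2) wre_add) simp
  next
    case GC then show ?thesis by (simp only: gperm_wre(3) wre_add) simp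
  next
    case GD then show ?thesis by (simp only: gperm_wre(4) wre_add) simp
  qed
  finally show ?case .
qed

text \<open>The pairs of classes modulo \<open>K\<close> that occur as the states of an element of \<open>G\<close> fixing the
  first level, and the class of that element, which they determine.\<close>

fun valid :: "kls \<Rightarrow> kls \<Rightarrow> bool" where
  "valid (Kls i j k n) (Kls i' j' k' n') \<longleftrightarrow> i' = k \<and> k' = i \<and> n' = (n \<noteq> (i \<and> k))"

fun prc :: "kls \<Rightarrow> kls \<Rightarrow> cls" where
  "prc (Kls i j k n) (Kls i' j' k' n') =
   Cls False (i \<noteq> k) ((i \<noteq> j) \<noteq> (k \<noteq> j')) k (j \<noteq> k)"

definition pr :: "kls \<Rightarrow> kls \<Rightarrow> kls" where "pr x y = kof (prc x y)"

text \<open>If w acts nontrivially on the first level, then w a fixes it and has the same states as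
  w; this explains the correction by \<open>gclass GA\<close>. Classes of the states modulo K thus
  give the class of w modulo the smaller subgroup M.\<close>

lemma class_states:
  "valid (kl (st w False)) (kl (st w True)) \<and>
   cl w = prc (kl (st w False)) (kl (st w True)) + (if active w then gclass GA else 0)"
proof (induction w)
  case Nil then show ?case by (simp add: zero_kls_def zero_cls_def)
next
  case (Cons x w)
  obtain i j k n where 0: "kl (st w False) = Kls i j k n" by (cases "kl (st w False)")
  obtain i' j' k' n' where 1: "kl (st w True) = Kls i' j' k' n'" by (cases "kl (st w True)")
  show ?case using Cons 0 1 by (cases x) (auto simp: zero_cls_def)
qed


section \<open>Realizing pairs of states\<close>

text \<open>Elements of \<open>G\<close> together with a class modulo \<open>K\<close>. Carrying the class along avoids proving
  that it does not depend on the word.\<close>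

definition Gam :: "(tperm \<times> kls) set" where "Gam = range (\<lambda>w. (E w, kl w))"

lemma Gam_word [simp]: "(E w, kl w) \<in> Gam" by (auto simp: Gam_def)

lemma GamE:
  assumes "x \<in> Gam" obtains w where "x = (E w, kl w)"
  using assms by (auto simp: Gam_def)

lemma Gam_0: "0 \<in> Gam"
  using Gam_word[of "[]"] by (simp add: zero_prod_def)

lemma Gam_add: "x \<in> Gam \<Longrightarrow> y \<in> Gam \<Longrightarrow> x + y \<in> Gam"
  by (elim GamE) (metis Gam_word E_simps(3) kl_simps(3) add_Pair)

lemma Gam_uminus: "x \<in> Gam \<Longrightarrow> - x \<in> Gam"
  by (elim GamE) (metis Gam_word E_rev kl_rev uminus_Pair)

lemma Gam_diff: "x \<in> Gam \<Longrightarrow> y \<in> Gam \<Longrightarrow> x - y \<in> Gam"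
  using Gam_add[OF _ Gam_uminus, of x y] by simp

text \<open>The stabilizer of the first level projects onto G in the first coordinate: b has first
  state a, and conjugation by a brings the second states b, c, d of d, b, c to the front.\<close>

fun lift_gen :: "gen \<Rightarrow> word" where
  "lift_gen GA = [GB]"
| "lift_gen GB = [GA, GD, GA]"
| "lift_gen GC = [GA, GB, GA]"
| "lift_gen GD = [GA, GC, GA]"

definition lift :: "word \<Rightarrow> word" where "lift w = concat (map lift_gen w)"

lemma active_lift [simp]: "active (lift w) = False"
proof (induction w)
  case (Cons x w) then show ?case by (cases x) (simp_all add: lift_def)
qed (simp add: lift_def)

lemma st_lift [simp]: "st (lift w) False = w"
proof (induction w)
  case (Cons x w) then show ?case using active_lift[of w] by (cases x) (simp_all add: lift_def)
qed (simp add: lift_def)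

lemma kl_states:
  assumes "\<not> active w"
  shows "valid (kl (st w False)) (kl (st w True))" "kl w = pr (kl (st w False)) (kl (st w True))"
  using class_states[of w] assms by (simp_all add: kl_def pr_def)

lemma Gam_states: "\<not> active w \<Longrightarrow>
  (wre (E (st w False)) (E (st w True)) False, pr (kl (st w False)) (kl (st w True))) \<in> Gam"
  using Gam_word[of w] E_st[of w] kl_states[of w] by simp

text \<open>The normal closure \<open>B\<close> of \<open>b\<close> satisfies \<open>1 \<times> B \<subseteq> G\<close>, because \<open>\<langle>\<langle>1, b\<rangle>\<rangle> = d\<close>, and \<open>G/B\<close> is the
  dihedral group of order 8, with the following normal forms.\<close>

fun dih :: "kls \<Rightarrow> word" where
  "dih (Kls i j k n) =
    (if i then [GA] else []) @ (if k then [GD] else []) @ (if n then [GA, GD, GA, GD] else [])"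

text \<open>Membership in B is replaced by its useful consequence, that <<1, w>> lies in G and has
  the expected class; this is what products propagate.\<close>

definition inB :: "word \<Rightarrow> bool" where
  "inB w \<longleftrightarrow> (wre 0 (E w) False, pr 0 (kl w)) \<in> Gam"

lemma pr_add:
  "valid x y \<Longrightarrow> valid x' y' \<Longrightarrow> pr (x + x') (y + y') = pr x y + pr x' y'"
  "valid x y \<Longrightarrow> valid x' y' \<Longrightarrow> valid (x + x') (y + y')"
  "valid x y \<Longrightarrow> pr (- x) (- y) = - pr x y"
  "valid x y \<Longrightarrow> valid (- x) (- y)"
  by (cases x; cases y; cases x'; cases y'; auto simp: pr_def)+

lemma valid_0: "valid 0 y \<longleftrightarrow> (\<exists>j. y = Kls False j False False)"
  by (cases y) (auto simp: zero_kls_def)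

lemma inB_valid_append:
  assumes "inB u" "inB v" "valid 0 (kl u)" "valid 0 (kl v)"
  shows "inB (u @ v)"
  using Gam_add[of "(wre 0 (E u) False, pr 0 (kl u))" "(wre 0 (E v) False, pr 0 (kl v))"]
    pr_add(1)[OF assms(3,4)] assms(1,2)
  by (simp add: inB_def wre_add)

lemma active_rev [simp]: "active (rev w) = active w"
  by (induction w) auto

lemma st_rev: "st (rev w) (i \<noteq> active w) = rev (st w i)"
proof (induction w arbitrary: i)
  case (Cons x w)
  have "st (rev w) (j \<noteq> active w) = rev (st w j)" for j by (rule Cons)
  from this[of True] this[of False] show ?case
    by (cases x; cases i; cases "active w"; simp)
qed simp
text \<open>Since d = <<1,b>>, it suffices to conjugate d by an element that fixes the first level
  and has second state g. Such an element is a u a, where u is the lift of g.\<close>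

lemma inB_conj_b: "inB (g @ [GB] @ rev g)"
proof -
  define u where "u = [GA] @ lift g @ [GA]"
  have u: "\<not> active u" "st u True = g" by (simp_all add: u_def)
  have r: "st (rev u) i = rev (st u i)" for i
    using st_rev[of u i] u by simp
  show ?thesis
    using Gam_states[of "u @ [GD] @ rev u"] u by (simp add: inB_def r)
qed

lemma inB_E_0:
  assumes "E w = 0" "kl w = 0"
  shows "inB w"
  using Gam_0 assms by (simp add: inB_def wre_0 pr_def zero_kls_def zero_cls_def zero_prod_def)

lemma inB_cong: "inB u \<Longrightarrow> E u = E v \<Longrightarrow> kl u = kl v \<Longrightarrow> inB v"
  by (simp add: inB_def)

lemma gperm_cancel [simp]: "gperm x + (gperm x + y) = y" "gperm x + gperm x = 0"
proof -
  show *: "gperm x + gperm x = 0" using left_minus[of "gperm x"] by (simp del: left_minus)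
  show "gperm x + (gperm x + y) = y" by (simp add: add.assoc[symmetric] *)
qed

lemma gperm_bc [simp]: "gperm GB + gperm GD = gperm GC"
proof -
  have "gen_d (gen_b w) = gen_c w \<and> gen_b (gen_c w) = gen_d w \<and> gen_c (gen_d w) = gen_b w" for w
  proof (induction w)
    case (Cons x w) then show ?case by (cases x) (auto simp: gen_involution)
  qed simp
  then show ?thesis
    by (simp add: Rep_tperm_inject[symmetric] Rep_plus Rep_gperm fun_eq_iff)
qed

lemma kl_dih: "kl (dih (Kls i j k n)) = Kls i False k n"
  by (cases i; cases k; cases n; simp add: zero_kls_def)

lemma valid_dih: "valid 0 (x - kl (dih x))"
  by (cases x) (simp only: kl_dih minus_Kls, auto simp: valid_0)

text \<open>These are the relations of the dihedral group generated by a and d, in particular (a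
  d)^4 = 1. They are visible in the states, which are words in b alone.\<close>

lemma inB_step_ad:
  assumes "x = GA \<or> x = GD"
  shows "inB (dih y @ [x] @ rev (dih (y + kl [x])))"
proof (rule inB_E_0)
  obtain i j k n where y: "y = Kls i j k n" by (cases y)
  show "E (dih y @ [x] @ rev (dih (y + kl [x]))) = 0"
    using assms unfolding y
    by (elim disjE; cases i; cases k; cases n; subst E_st; simp add: wre_0 zero_kls_def)
  show "kl (dih y @ [x] @ rev (dih (y + kl [x]))) = 0"
    using assms unfolding y
    by (elim disjE; cases i; cases k; cases n; simp add: zero_kls_def)
qed

text \<open>Rewriting in the manner of Schreier: the word telescopes into factors
  \<open>dih y @ [x] @ rev (dih (y + kl [x]))\<close>. Such a factor is trivial for a and d and a
  conjugate of b for b; for c = b d it is a product of these two kinds.\<close>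

lemma inB_dih: "inB (v @ rev (dih (kl v)))"
proof (induction v rule: rev_induct)
  case Nil
  show ?case by (rule inB_E_0) (simp_all add: zero_kls_def)
next
  case (snoc x v)
  let ?y = "kl v"
  have step: "inB (dih ?y @ [x] @ rev (dih (?y + kl [x])))"
    (is "inB ?w") if "x \<noteq> GC"
  proof (cases "x = GB")
    case True
    have "dih (?y + kl [GB]) = dih ?y" by (cases ?y) (simp add: zero_kls_def)
    then show ?thesis using True inB_conj_b[of "dih ?y"] by simp
  next
    case False
    then show ?thesis using that by (intro inB_step_ad) (cases x; simp)
  qed
  have v: "valid 0 (kl (dih ?y @ [x] @ rev (dih (?y + kl [x]))))" for x
    by (cases ?y; cases x) (auto simp: valid_0 kl_dih zero_kls_def simp del: dih.simps)
  have c: "inB (dih ?y @ [GC] @ rev (dih (?y + kl [GC])))"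
  proof -
    have 1: "?y + kl [GC] = ?y + kl [GD] + Kls False True False False"
      by (cases ?y) (simp add: zero_kls_def)
    have 2: "dih (y + Kls False True False False) = dih y" for y by (cases y) simp
    have "inB ((dih ?y @ [GB] @ rev (dih ?y)) @ (dih ?y @ [GD] @ rev (dih (?y + kl [GD]))))"
    proof (rule inB_valid_append[OF inB_conj_b inB_step_ad])
      show "valid 0 (kl (dih ?y @ [GB] @ rev (dih ?y)))"
        by (cases ?y) (auto simp: valid_0 kl_dih zero_kls_def simp del: dih.simps)
    qed (simp_all only: v simp_thms)
    then show ?thesis
    proof (rule inB_cong)
      show "E ((dih ?y @ [GB] @ rev (dih ?y)) @ dih ?y @ [GD] @ rev (dih (?y + kl [GD]))) =
        E (dih ?y @ [GC] @ rev (dih (?y + kl [GC])))"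
        unfolding 1 2 by (simp add: add.assoc)
          (simp add: add_diff_eq)
      show "kl ((dih ?y @ [GB] @ rev (dih ?y)) @ dih ?y @ [GD] @ rev (dih (?y + kl [GD]))) =
        kl (dih ?y @ [GC] @ rev (dih (?y + kl [GC])))"
        unfolding 1 2 by (cases ?y) (auto simp: kl_dih zero_kls_def simp del: dih.simps)
    qed
  qed
  have "inB ((v @ rev (dih ?y)) @ (dih ?y @ [x] @ rev (dih (?y + kl [x]))))"
  proof (rule inB_valid_append[OF snoc _ _ v])
    show "inB (dih ?y @ [x] @ rev (dih (?y + kl [x])))"
    proof (cases "x = GC")
      case True show ?thesis unfolding True by (rule c)
    next
      case False then show ?thesis by (rule step)
    qed
    show "valid 0 (kl (v @ rev (dih ?y)))" using valid_dih[of ?y] by simp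
  qed
  then show ?case
    by (rule inB_cong) (simp_all add: add.assoc)
qed

text \<open>The lift of the first state has some second state, which differs from the prescribed one
  by an element whose normal form in G/B is empty. That element lies in B, and 1 x B is contained in
  G, so the second state can be corrected.\<close>

lemma Gam_wre:
  assumes "x \<in> Gam" "y \<in> Gam" "valid (snd x) (snd y)"
  shows "(wre (fst x) (fst y) s, pr (snd x) (snd y) + (if s then kl [GA] else 0)) \<in> Gam"
proof -
  obtain u v where x: "x = (E u, kl u)" and y: "y = (E v, kl v)" using assms by (elim GamE)
  let ?u = "st (lift u) True"
  have vu: "valid (kl u) (kl ?u)" and ku: "kl (lift u) = pr (kl u) (kl ?u)"
    using kl_states[of "lift u"] by simp_all
  have vv: "valid 0 (kl (rev ?u @ v))"
    using vu assms(3) unfolding x y valid_0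
    by (cases "kl u"; cases "kl v"; cases "kl ?u") auto
  have "dih (kl (rev ?u @ v)) = []"
    using vv by (auto simp: valid_0 simp del: kl_simps)
  then have "inB (rev ?u @ v)" using inB_dih[of "rev ?u @ v"] by simp
  then have "(E (lift u), kl (lift u)) + (wre 0 (E (rev ?u @ v)) False, pr 0 (kl (rev ?u @ v))) \<in> Gam"
    unfolding inB_def by (intro Gam_add Gam_word)
  moreover have "E (lift u) + wre 0 (E (rev ?u @ v)) False = wre (E u) (E v) False"
    using E_st[of "lift u"] by (simp add: wre_add add.assoc[symmetric])
  moreover have "kl (lift u) + pr 0 (kl (rev ?u @ v)) = pr (kl u) (kl v)"
    using pr_add(1)[OF vu vv] ku by (simp add: add.assoc[symmetric])
  ultimately have 0: "(wre (E u) (E v) False, pr (kl u) (kl v)) \<in> Gam" by simp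
  show ?thesis
    using Gam_add[OF 0 Gam_word[of "[GA]"]] 0 x y
    by (cases s) (auto simp: gperm_wre(1) wre_add)
qed

section \<open>Products of commutators\<close>

definition comm :: "'a::group_add \<Rightarrow> 'a \<Rightarrow> 'a" where "comm x y = - x - y + x + y"

fun comms :: "'a::group_add list \<Rightarrow> 'a" where
  "comms (x # y # xs) = comm x y + comms xs"
| "comms _ = 0"

text \<open>Elementary moves, generating the action of the mapping class group of a surface with one
  boundary component on its representations: they preserve the product of commutators.\<close>

fun tw :: "nat \<Rightarrow> 'a::group_add list \<Rightarrow> 'a list" where
  "tw 0 (x # y # xs) = (y + x) # y # xs"
| "tw (Suc 0) (x # y # xs) = x # (x + y) # xs"
| "tw (Suc (Suc 0)) (x # y # z # w # xs) =
    (let u = y - z in (- u + x) # (- u + y + u) # (- u + z + u) # (- u + w) # xs)"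
| "tw (Suc (Suc (Suc n))) (x # y # xs) = x # y # tw n xs"
| "tw _ xs = xs"

abbreviation tws :: "nat list \<Rightarrow> 'a::group_add list \<Rightarrow> 'a list" where "tws \<equiv> fold tw"

lemma diff_plus: "x - y = x + - (y::'a::group_add)" by simp

lemma add_minus_cancels: "x + (- x + y) = y" "- x + (x + y) = (y::'a::group_add)"
  by (simp_all add: add.assoc[symmetric])

lemma comms_tw: "comms (tw n xs) = comms xs"
proof (induction n xs rule: tw.induct)
  case (3 x y z w xs)
  show ?case
    by (simp add: comm_def Let_def minus_add add.assoc add_minus_cancels diff_plus
        del: add_uminus_conv_diff)
qed (simp_all add: comm_def minus_add add.assoc add_minus_cancels diff_plus
        del: add_uminus_conv_diff)

lemma comms_tws: "comms (tws p xs) = comms xs"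
  by (induction p arbitrary: xs) (simp_all add: comms_tw)

lemma map_snd_tw: "map snd (tw n xs) = tw n (map snd (xs :: ('a::group_add \<times> 'b::group_add) list))"
  by (induction n xs rule: tw.induct) (simp_all add: Let_def)

lemma map_snd_tws:
  "map snd (tws p xs) = tws p (map snd (xs :: ('a::group_add \<times> 'b::group_add) list))"
  by (induction p arbitrary: xs) (simp_all add: map_snd_tw)

lemma Gam_tw: "set xs \<subseteq> Gam \<Longrightarrow> set (tw n xs) \<subseteq> Gam"
  by (induction n xs rule: tw.induct) (auto simp: Let_def intro!: Gam_add Gam_diff Gam_uminus)

lemma Gam_tws: "set xs \<subseteq> Gam \<Longrightarrow> set (tws p xs) \<subseteq> Gam"
  by (induction p arbitrary: xs) (simp_all add: Gam_tw)

lemma fst_comms: "fst (comms xs) = comms (map fst (xs :: ('a::group_add \<times> 'b::group_add) list))"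
  by (induction xs rule: comms.induct) (simp_all add: comm_def)

definition Sol :: "kls list \<Rightarrow> tperm \<Rightarrow> bool" where
  "Sol t h \<longleftrightarrow> (\<exists>xs. set xs \<subseteq> Gam \<and> map snd xs = t \<and> comms (map fst xs) = h)"

lemma Sol_tws: "Sol t h \<Longrightarrow> Sol (tws p t) h"
  unfolding Sol_def by (metis Gam_tws map_snd_tws fst_comms comms_tws)

lemma Sol_append_0: "Sol t h \<Longrightarrow> even (length t) \<Longrightarrow> Sol (t @ [0, 0]) h"
proof -
  assume "Sol t h" and l: "even (length t)"
  then obtain xs where xs: "set xs \<subseteq> Gam" "map snd xs = t" "comms (map fst xs) = h"
    by (auto simp: Sol_def)
  have "comms (ys @ [0, 0]) = comms ys" if "even (length ys)" for ys :: "tperm list"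
    using that by (induction ys rule: comms.induct) (simp_all add: comm_def)
  then have "comms (map fst (xs @ [0, 0])) = h"
    using xs l by auto
  then show "Sol (t @ [0, 0]) h"
    using xs Gam_0 by (auto simp: Sol_def intro!: exI[of _ "xs @ [0, 0]"])
qed

lemma comms_conj:
  "comms (map (\<lambda>x. - g + x + g) xs) = - g + comms xs + (g::'a::group_add)"
  by (induction xs rule: comms.induct)
    (simp_all add: comm_def minus_add add.assoc add_minus_cancels diff_plus del: add_uminus_conv_diff)

lemma Sol_conj:
  assumes "Sol t h"
  shows "Sol (map (\<lambda>x. - kl g + x + kl g) t) (- E g + h + E g)"
proof -
  obtain xs where xs: "set xs \<subseteq> Gam" "map snd xs = t" "comms (map fst xs) = h"
    using assms by (auto simp: Sol_def)
  let ?g = "(E g, kl g)"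
  let ?ys = "map (\<lambda>x. - ?g + x + ?g) xs"
  have "set ?ys \<subseteq> Gam" using xs(1) by (auto intro!: Gam_add Gam_uminus simp del: uminus_Pair)
  moreover have "map snd ?ys = map (\<lambda>x. - kl g + x + kl g) t" using xs(2) by auto
  moreover have "comms (map fst ?ys) = - E g + h + E g"
    using comms_conj[of "E g" "map fst xs"] xs(3) by (simp add: comp_def)
  ultimately show ?thesis unfolding Sol_def by blast
qed

lemma Sol_4E:
  assumes "Sol [a, b, c, d] h"
  obtains p q r s where "(p, a) \<in> Gam" "(q, b) \<in> Gam" "(r, c) \<in> Gam" "(s, d) \<in> Gam"
    "comm p q + comm r s = h"
proof -
  obtain xs where xs: "set xs \<subseteq> Gam" "map snd xs = [a, b, c, d]" "comms (map fst xs) = h"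
    using assms unfolding Sol_def by (elim exE conjE)
  have "length xs = Suc (Suc (Suc (Suc 0)))" using arg_cong[OF xs(2), of length] by simp
  then obtain w x y z where w: "xs = [w, x, y, z]"
    by (auto simp: length_Suc_conv)
  show ?thesis
    by (rule that[of "fst w" "fst x" "fst y" "fst z"]) (use xs in \<open>auto simp: w\<close>)
qed

lemma Sol_6E:
  assumes "Sol [a, b, c, d, e, f] h"
  obtains p q r s u v where "(p, a) \<in> Gam" "(q, b) \<in> Gam" "(r, c) \<in> Gam" "(s, d) \<in> Gam"
    "(u, e) \<in> Gam" "(v, f) \<in> Gam" "comm p q + comm r s + comm u v = h"
proof -
  obtain xs where xs: "set xs \<subseteq> Gam" "map snd xs = [a, b, c, d, e, f]" "comms (map fst xs) = h"
    using assms unfolding Sol_def by (elim exE conjE)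
  have "length xs = Suc (Suc (Suc (Suc (Suc (Suc 0)))))"
    using arg_cong[OF xs(2), of length] by simp
  then obtain w x y z k l where w: "xs = [w, x, y, z, k, l]"
    by (auto simp: length_Suc_conv)
  show ?thesis
    by (rule that[of "fst w" "fst x" "fst y" "fst z" "fst k" "fst l"])
      (use xs in \<open>auto simp: w add.assoc\<close>)
qed

lemma Sol_4I:
  "(p, a) \<in> Gam \<Longrightarrow> (q, b) \<in> Gam \<Longrightarrow> (r, c) \<in> Gam \<Longrightarrow> (s, d) \<in> Gam \<Longrightarrow>
   Sol [a, b, c, d] (comm p q + comm r s)"
  unfolding Sol_def by (rule exI[of _ "[(p, a), (q, b), (r, c), (s, d)]"]) simp

text \<open>If the first of four elements acts nontrivially on the first level and the others do not,
  the equation \<open>h = [p,q][r,s]\<close> becomes a single equation for the states, in three commutators;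
  it is solved by one in two commutators after moving the classes of the third one into \<open>K\<close>.\<close>

definition merges :: "kls list \<Rightarrow> kls \<Rightarrow> kls \<Rightarrow> kls \<Rightarrow> kls list \<Rightarrow> nat list \<Rightarrow> nat list \<Rightarrow> bool" where
  "merges t c1 c2 cx t' p p' \<longleftrightarrow> length t' = 4 \<and>
    (case tws p (t' @ [0, 0]) of [T, Q, z, w, z', w'] \<Rightarrow>
      (let x = T - cx; g = cx + c1; z2 = g + z' - g; w2 = g + w' - g; y = - x + Q + x + c2 - comm z2 w2
       in valid x cx \<and> valid Q y \<and> valid z z2 \<and> valid w w2 \<and>
          tws p' [pr x cx + kl [GA], pr Q y, pr z z2, pr w w2] = t)
     | _ \<Rightarrow> False)"

text \<open>With p = <<x1,x2>>a, q = <<y1,y2>>, r = <<z1,z>> and s = <<w1,w>>, the conclusions are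
  the two state equations of [p,q][r,s] = <<h1,h2>>. The second one determines y2. Inserting it into
  the first leaves x1 only in t = x1 x2, so x2 can be chosen in advance; conjugating z and w by x2
  h1 moves their commutator to the end.\<close>

lemma active_step:
  fixes h1 h2 t x2 y1 :: "'a::group_add"
  assumes "comm t y1 + comm z1 w1 + comm z2 w2 = - x2 + h2 + x2 + h1"
  defines "x1 \<equiv> t - x2"
  defines "z \<equiv> (x2 + h1) + z2 - (x2 + h1)" and "w \<equiv> (x2 + h1) + w2 - (x2 + h1)"
  defines "y2 \<equiv> - x1 + y1 + x1 + h2 - comm z w"
  shows "- x2 - y2 + x2 + y1 + comm z1 w1 = h1" "- x1 - y1 + x1 + y2 + comm z w = h2"
proof -
  show "- x1 - y1 + x1 + y2 + comm z w = h2"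
    unfolding y2_def
    by (simp add: minus_add add.assoc add_minus_cancels diff_plus del: add_uminus_conv_diff)
  have zw: "comm z w = (x2 + h1) + comm z2 w2 - (x2 + h1)"
    unfolding z_def w_def comm_def
    by (simp add: minus_add add.assoc add_minus_cancels diff_plus del: add_uminus_conv_diff)
  have c: "comm t y1 = - x2 + h2 + x2 + h1 - comm z2 w2 - comm z1 w1"
    using assms(1) by (simp only: eq_diff_eq)
  have "- x2 - y2 + x2 + y1 = - x2 + comm z w - h2 + x2 + comm t y1"
    unfolding y2_def x1_def comm_def[of t]
    by (simp add: minus_add add.assoc add_minus_cancels diff_plus del: add_uminus_conv_diff)
  also have "\<dots> = h1 - comm z1 w1"
    unfolding c zw
    by (simp add: minus_add add.assoc add_minus_cancels diff_plus del: add_uminus_conv_diff)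
  finally show "- x2 - y2 + x2 + y1 + comm z1 w1 = h1" by simp
qed

text \<open>The reduction runs backwards: a solution for \<open>t'\<close>, padded by a trivial
  commutator, is carried by the moves \<open>p\<close> to a solution in three commutators whose
  classes belong to states of elements of G. The elements reassembled from these states are brought
  to the classes \<open>t\<close> by \<open>p'\<close>.\<close>

lemma Sol_merge:
  assumes m: "merges t (kl (st w False)) (kl (st w True)) (kl x) t' p p'" and "\<not> active w"
    and S: "Sol t' (E (rev x @ st w True @ x @ st w False))"
  shows "Sol t (E w)"
proof -
  define h1 where "h1 = st w False"
  define h2 where "h2 = st w True"
  obtain T Q z w1 z' w' where u: "tws p (t' @ [0, 0]) = [T, Q, z, w1, z', w']"
    using m by (auto simp: merges_def split: list.splits)
  have "Sol [T, Q, z, w1, z', w'] (E (rev x @ h2 @ x @ h1))"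
    using Sol_tws[OF Sol_append_0[OF S], of p] m u by (simp add: merges_def h1_def h2_def)
  then obtain et eq ez ew ez' ew' where G: "(et, T) \<in> Gam" "(eq, Q) \<in> Gam" "(ez, z) \<in> Gam"
    "(ew, w1) \<in> Gam" "(ez', z') \<in> Gam" "(ew', w') \<in> Gam"
    and eqn: "comm et eq + comm ez ew + comm ez' ew' = E (rev x @ h2 @ x @ h1)"
    by (rule Sol_6E)
  define g where "g = (E (x @ h1), kl (x @ h1))"
  define X where "X = (et, T) - (E x, kl x)"
  define Z where "Z = g + (ez', z') - g"
  define W where "W = g + (ew', w') - g"
  define Y where "Y = - X + (eq, Q) + X + (E h2, kl h2) - comm Z W"
  have XZWY: "X \<in> Gam" "Z \<in> Gam" "W \<in> Gam"
    unfolding X_def Z_def W_def g_def by (intro Gam_add Gam_diff Gam_word G)+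
  moreover have "comm Z W \<in> Gam"
    unfolding comm_def by (intro Gam_add Gam_diff Gam_uminus XZWY)
  ultimately have Y: "Y \<in> Gam"
    unfolding Y_def by (intro Gam_add Gam_diff Gam_uminus Gam_word G)
  have s: "snd X = T - kl x" "snd Z = (kl x + kl h1) + z' - (kl x + kl h1)"
    "snd W = (kl x + kl h1) + w' - (kl x + kl h1)"
    "snd Y = - snd X + Q + snd X + kl h2 - comm (snd Z) (snd W)"
    by (simp_all add: X_def Y_def Z_def W_def g_def comm_def)
  have v: "valid (snd X) (kl x)" "valid Q (snd Y)" "valid z (snd Z)" "valid w1 (snd W)"
    and t: "tws p' [pr (snd X) (kl x) + kl [GA], pr Q (snd Y), pr z (snd Z), pr w1 (snd W)] = t"
    using m u unfolding merges_def Let_def s h1_def h2_def by simp_all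
  have f: "- E x - fst Y + E x + eq + comm ez ew = E h1"
    "- fst X - eq + fst X + fst Y + comm (fst Z) (fst W) = E h2"
    using active_step[of et eq ez ew ez' ew' "E x" "E h2" "E h1"] eqn
    by (simp_all add: X_def Y_def Z_def W_def g_def comm_def add.assoc)
  have "Sol [pr (snd X) (kl x) + kl [GA], pr Q (snd Y), pr z (snd Z), pr w1 (snd W)]
    (comm (wre (fst X) (E x) True) (wre eq (fst Y) False) +
     comm (wre ez (fst Z) False) (wre ew (fst W) False))"
    using Gam_wre[OF XZWY(1) Gam_word[of x], of True] Gam_wre[OF G(2) Y, of False]
      Gam_wre[OF G(3) XZWY(2), of False] Gam_wre[OF G(4) XZWY(3), of False] v
    by (intro Sol_4I) simp_all
  also have "comm (wre (fst X) (E x) True) (wre eq (fst Y) False) +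
     comm (wre ez (fst Z) False) (wre ew (fst W) False) = wre (E h1) (E h2) False"
    using f by (simp add: comm_def[of "wre _ _ _"] diff_plus wre_uminus wre_add add.assoc
        comm_def[of ez] comm_def[of "fst Z"] del: add_uminus_conv_diff)
  also have "\<dots> = E w"
    using E_st[of w] assms(2) by (simp add: h1_def h2_def)
  finally show ?thesis using Sol_tws[of _ _ p'] t by metis
qed

text \<open>The equations for the two states are independent except that the classes must match
  entry by entry under \<open>valid\<close>; the moves \<open>p1\<close> and \<open>p2\<close> look
  for matching systems in the two orbits.\<close>

definition splits :: "kls list \<Rightarrow> kls list \<Rightarrow> kls list \<Rightarrow> nat list \<Rightarrow> nat list \<Rightarrow> nat list \<Rightarrow> bool" where
  "splits t t1 t2 p1 p2 p \<longleftrightarrow> length t1 = 4 \<and>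
    (let u = tws p1 t1; v = tws p2 t2 in list_all2 valid u v \<and> tws p (map2 pr u v) = t)"

lemma comms_wre:
  "length xs = length ys \<Longrightarrow>
   comms (map2 (\<lambda>x y. wre x y False) xs ys) = wre (comms xs) (comms ys) False"
proof (induction xs arbitrary: ys rule: comms.induct)
  case (1 x y xs)
  then obtain x' y' ys' where "ys = x' # y' # ys'" "length xs = length ys'"
    by (auto simp: Suc_length_conv length_Suc_conv)
  then show ?case using 1
    by (simp add: comm_def diff_plus wre_uminus wre_add add.assoc del: add_uminus_conv_diff)
next
  case ("2_2" v)
  then show ?case by (cases ys) (auto simp: wre_0)
qed (auto simp: wre_0)

lemma Sol_split:
  assumes "splits t t1 t2 p1 p2 p" "\<not> active w"
    and "Sol t1 (E (st w False))" "Sol t2 (E (st w True))"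
  shows "Sol t (E w)"
proof -
  let ?u = "tws p1 t1" and ?v = "tws p2 t2"
  have "Sol ?u (E (st w False))" "Sol ?v (E (st w True))"
    using assms by (auto intro: Sol_tws)
  then obtain xs ys where xs: "set xs \<subseteq> Gam" "map snd xs = ?u" "comms (map fst xs) = E (st w False)"
    and ys: "set ys \<subseteq> Gam" "map snd ys = ?v" "comms (map fst ys) = E (st w True)"
    unfolding Sol_def by auto
  have v: "list_all2 valid ?u ?v" and t: "tws p (map2 pr ?u ?v) = t"
    using assms(1) by (auto simp: splits_def Let_def)
  have l: "length xs = length ys"
    using list_all2_lengthD[OF v] xs(2) ys(2) by (metis length_map)
  let ?zs = "map2 (\<lambda>x y. (wre (fst x) (fst y) False, pr (snd x) (snd y))) xs ys"
  have "valid (snd x) (snd y)" if "(x, y) \<in> set (zip xs ys)" for x y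
    using v that unfolding xs(2)[symmetric] ys(2)[symmetric]
    by (auto simp: list_all2_iff zip_map_map)
  moreover have "x \<in> Gam" "y \<in> Gam" if "(x, y) \<in> set (zip xs ys)" for x y
    using xs(1) ys(1) that by (auto dest: set_zip_leftD set_zip_rightD)
  ultimately have "(wre (fst x) (fst y) False, pr (snd x) (snd y)) \<in> Gam"
    if "(x, y) \<in> set (zip xs ys)" for x y
    using Gam_wre[of x y False] that by simp
  then have "set ?zs \<subseteq> Gam" by (simp only: set_map image_subset_iff split_def Ball_def) (metis prod.collapse)
  moreover have "map snd ?zs = map2 pr ?u ?v"
    unfolding xs(2)[symmetric] ys(2)[symmetric] by (simp add: zip_map_map comp_def split_def)
  moreover have "comms (map fst ?zs) = E w"
  proof -
    have "map fst ?zs = map2 (\<lambda>x y. wre x y False) (map fst xs) (map fst ys)"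
      by (simp add: zip_map_map comp_def split_def)
    then show ?thesis
      using comms_wre[of "map fst xs" "map fst ys"] l xs(3) ys(3) E_st[of w] assms(2) by simp
  qed
  ultimately have "Sol (map2 pr ?u ?v) (E w)" unfolding Sol_def by blast
  then show ?thesis using Sol_tws t by metis
qed

text \<open>Conjugating a solution also conjugates the prescribed classes. If moves can restore
  them, solvability passes to conjugates of h, and words may be treated cyclically.\<close>

lemma Sol_conj_tws:
  assumes "Sol t (E w)" "tws p (map (\<lambda>x. - kl g + x + kl g) t) = t"
  shows "Sol t (E (rev g @ w @ g))"
  using Sol_tws[OF Sol_conj[OF assms(1), of g], of p] assms(2) by (simp add: add.assoc)

section \<open>Tables of reductions between systems of classes\<close>

text \<open>Classes modulo \<open>K\<close> are named after a representing word, and systems of classes after their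
  entries, \<open>1\<close> standing for \<open>K\<close>. The sequences of moves were found by breadth-first search.\<close>

abbreviation "ka \<equiv> Kls True False False False"
abbreviation "kb \<equiv> Kls False True False False"
abbreviation "kc \<equiv> Kls False True True False"
abbreviation "kd \<equiv> Kls False False True False"
abbreviation "kac \<equiv> Kls True True True False"
abbreviation "kad \<equiv> Kls True False True False"
abbreviation "kca \<equiv> Kls True True True True"
abbreviation "kda \<equiv> Kls True False True True"
abbreviation "kaca \<equiv> Kls False True True True"
abbreviation "kada \<equiv> Kls False False True True"
abbreviation "kacac \<equiv> Kls False False False True"
abbreviation "kacad \<equiv> Kls False True False True"

abbreviation "tac_b_1_1 \<equiv> [kac, kb, 0, 0]"
abbreviation "ta_b_b_c \<equiv> [ka, kb, kb, kc]"
abbreviation "ta_b_1_c \<equiv> [ka, kb, 0, kc]"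
abbreviation "ta_c_1_b \<equiv> [ka, kc, 0, kb]"
abbreviation "ta_c_d_ada \<equiv> [ka, kc, kd, kada]"
abbreviation "ta_d_c_ada \<equiv> [ka, kd, kc, kada]"
abbreviation "ta_d_b_c \<equiv> [ka, kd, kb, kc]"
abbreviation "ta_1_b_c \<equiv> [ka, 0, kb, kc]"
abbreviation "tac_1_1_b \<equiv> [kac, 0, 0, kb]"
abbreviation "ta_1_1_c \<equiv> [ka, 0, 0, kc]"
abbreviation "ta_1_c_aca \<equiv> [ka, 0, kc, kaca]"
abbreviation "ta_1_1_d \<equiv> [ka, 0, 0, kd]"
abbreviation "ta_1_1_acac \<equiv> [ka, 0, 0, kacac]"
abbreviation "t1_b_1_acac \<equiv> [0, kb, 0, kacac]"
abbreviation "t1_1_1_b \<equiv> [0, 0, 0, kb]"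
abbreviation "t1_c_1_aca \<equiv> [0, kc, 0, kaca]"

text \<open>The rows run through the two orders in which the states of an element of the class of (a
  b)^2 have the classes of a c and c a, and through the conjugators 1 and b.\<close>

lemma merges_tac_b_1_1:
  "merges tac_b_1_1 kac kca 0 ta_b_1_c [0,1,3,5,2,6,5] [4,3,2]"
  "merges tac_b_1_1 kac kca kb ta_b_1_c [0,2,1,3,5,2,6,5] [4,3,2,1,1]"
  "merges tac_b_1_1 kca kac 0 ta_b_1_c [0,1,2,3,5] [0]"
  "merges tac_b_1_1 kca kac kb ta_b_1_c [1,2,3,5] [2,1,1,2,0]"
  by (simp_all add: merges_def numeral_eq_Suc Let_def comm_def pr_def zero_kls_def)

lemma merges_ta_b_b_c:
  "merges ta_b_b_c kac kca 0 ta_b_1_c [0,2,3,5,2,1,6,5,2,4,5] [3,4]"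
  "merges ta_b_b_c kac kca kb ta_b_1_c [1,0,2,1,0,5,6,5,2,1,0,4,5] [2,0,3]"
  "merges ta_b_b_c kca kac 0 ta_b_1_c [2,1,0,5,2,1,6,5,2] [4,3,4]"
  "merges ta_b_b_c kca kac kb ta_b_1_c [1,3,2,5,2,1,4,6,5] [2,3,4]"
  by (simp_all add: merges_def numeral_eq_Suc Let_def comm_def pr_def zero_kls_def)

lemma merges_ta_b_1_c:
  "merges ta_b_1_c kac kca 0 ta_b_b_c [0,1,4,3,5,2,6,5] [4,3]"
  "merges ta_b_1_c kac kca kb ta_b_b_c [1,3,5,2,4,6,5,2,1] [3,2,4,3]"
  "merges ta_b_1_c kca kac 0 ta_b_b_c [1,2,4,3,5] [3,2,0,1,1,4,3,2,3]"
  "merges ta_b_1_c kca kac kb ta_b_b_c [1,2,4,3,5] [3,2,1,1,4,3,2,0,3]"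
  by (simp_all add: merges_def numeral_eq_Suc Let_def comm_def pr_def zero_kls_def)

text \<open>State classes a d and d a arise from elements of the class of (a c)^2.\<close>

lemma merges_ta_c_1_b:
  "merges ta_c_1_b kad kda 0 ta_b_b_c [0,1,3,5,2,6,5] [1,2,0,2,0,1,4,3]"
  "merges ta_c_1_b kad kda kb ta_b_b_c [1,3,5,2,4,6,5,2,1] [2,4,3]"
  "merges ta_c_1_b kda kad 0 ta_b_b_c [1,2,4,3,5] [3,0,2,1,1,4,3,2,3]"
  "merges ta_c_1_b kda kad kb ta_b_b_c [1,2,3,5] [4,3,2,1,1,0]"
  by (simp_all add: merges_def numeral_eq_Suc Let_def comm_def pr_def zero_kls_def)

lemma merges_ta_c_d_ada:
  "merges ta_c_d_ada kad kda 0 ta_b_b_c [0,1,2,5,2,1,0,1,2,6,7,6] []"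
  "merges ta_c_d_ada kad kda kb ta_b_b_c [0,1,3,5,2,6,5] [0,4,3,2,4,3]"
  "merges ta_c_d_ada kda kad 0 ta_b_b_c [0,1,2,3,5] [3,4]"
  "merges ta_c_d_ada kda kad kb ta_b_b_c [1,2,4,3,5] [1,0,0,1,3,4]"
  by (simp_all add: merges_def numeral_eq_Suc Let_def comm_def pr_def zero_kls_def)

text \<open>For an element of the class of (a d)^2 both states have class b or both have class a c a
  d. The conjugator a serves the former case, b the latter.\<close>

lemma merges_ta_d_c_ada:
  "merges ta_d_c_ada kb kb 0 ta_b_1_c [2,5,2,1,4,3,2,6,5,4,3] [4,3]"
  "merges ta_d_c_ada kb kb ka ta_b_b_c [3,4,5,2,1,1,1,0,6,5,2] [3,2]"
  "merges ta_d_c_ada kacad kacad 0 ta_b_1_c [3,2,1,4,5,2] [4,3,4]"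
  "merges ta_d_c_ada kacad kacad 0 ta_1_b_c [3,2,1,4,5,2,1] [2,0,3,4]"
  "merges ta_d_c_ada kacad kacad kb ta_1_b_c [3,4,3,2,1,5,2] [0,4,3,4]"
  by (simp_all add: merges_def numeral_eq_Suc Let_def comm_def pr_def zero_kls_def)

lemma merges_ta_d_b_c:
  "merges ta_d_b_c kb kb 0 ta_b_1_c [1,3,2,1,4,5,2,6,5,4] [4,3]"
  "merges ta_d_b_c kb kb ka ta_b_b_c [5,2,1,0,6,5,2,3,4,5,7,6] [2,1,1,0,4,3,4]"
  "merges ta_d_b_c kacad kacad 0 ta_b_1_c [5,2,1,4,3,2] [4,3,1,2,0,2,0,1]"
  "merges ta_d_b_c kacad kacad 0 ta_1_b_c [2,3,4,5,2,1,6,5,2] [4,3]"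
  "merges ta_d_b_c kacad kacad kb ta_1_b_c [3,2,1,4,5,2] [0,1,4,3,2,2,1]"
  by (simp_all add: merges_def numeral_eq_Suc Let_def comm_def pr_def zero_kls_def)

text \<open>The states of an element of M both lie in K or both in the class of (a c)^2 modulo
  K.\<close>

lemma merges_ta_1_b_c:
  "merges ta_1_b_c 0 0 0 ta_b_1_c [1,3,2,1,4,5,2,6,5,4] [4,3]"
  "merges ta_1_b_c kacac kacac 0 ta_b_1_c [5,2,1,4,3,2] [1,2,3,3,2,1,4,3]"
  by (simp_all add: merges_def numeral_eq_Suc Let_def comm_def pr_def zero_kls_def)

lemma merges_tac_1_1_b:
  "merges tac_1_1_b 0 0 0 ta_b_b_c [3,4,3,2,1,5,2,6,5,4,3] [2,4,3]"
  "merges tac_1_1_b kacac kacac 0 ta_b_b_c [3,4,3,2,1,5,2] [3,2,4,3]"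
  by (simp_all add: merges_def numeral_eq_Suc Let_def comm_def pr_def zero_kls_def)

lemma merges_ta_1_1_c:
  "merges ta_1_1_c 0 0 0 ta_b_b_c [4,5,2,1,6,5,2,4,3,3,5,4] [3]"
  "merges ta_1_1_c kacac kacac 0 ta_b_b_c [0,1,0,4,3,2,2,5,2,1,6,5,2,7] [3]"
  "merges ta_1_1_c 0 0 0 ta_1_1_d [1,0,5,4,6,5,2,1,3,2] [4,3]"
  by (simp_all add: merges_def numeral_eq_Suc Let_def comm_def pr_def zero_kls_def)

lemma merges_ta_1_c_aca:
  "merges ta_1_c_aca 0 0 0 ta_b_b_c [1,0,3,5,2,1,6,5,2,6,5,6,7] []"
  "merges ta_1_c_aca kacac kacac 0 ta_b_b_c [3,4,5,2,1,6,5,2] [3]"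
  "merges ta_1_c_aca kacac kacac 0 ta_1_1_d [3,2,1,4,5,2] [0,1,3,2,2,1]"
  by (simp_all add: merges_def numeral_eq_Suc Let_def comm_def pr_def zero_kls_def)

lemma merges_ta_1_1_d:
  "merges ta_1_1_d 0 0 0 tac_b_1_1 [2,1,0,5,2,1,6,5,2,6,7,6] []"
  "merges ta_1_1_d kacac kacac 0 tac_b_1_1 [2,1,5,2,3,6,5] [4,3]"
  "merges ta_1_1_d 0 0 0 t1_1_1_b [5,4,6,5] [4,3]"
  "merges ta_1_1_d 0 0 0 t1_b_1_acac [3,5,2] [2,1,1,3,2,4,3]"
  "merges ta_1_1_d 0 0 0 tac_1_1_b [1,2,5,4,6,5,2,1,0,3,2] [4,3]"
  "merges ta_1_1_d kacac kacac 0 tac_1_1_b [1,0,0,0,5,4,6,5] [4,3]"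
  "merges ta_1_1_d kacac kacac kb tac_1_1_b [1,5,2,3,6,5] [2,3]"
  by (simp_all add: merges_def numeral_eq_Suc Let_def comm_def pr_def zero_kls_def)

lemma merges_ta_1_1_acac:
  "merges ta_1_1_acac kacac kacac 0 tac_1_1_b [1,2,3,5] []"
  "merges ta_1_1_acac kacac kacac kb tac_1_1_b [1,2,3,5] [3,2,4,3]"
  by (simp_all add: merges_def numeral_eq_Suc Let_def comm_def pr_def zero_kls_def)

text \<open>One row each for both states in the class of (a c)^2, of (a d)^2 and of (a b)^2.\<close>

lemma splits_t1_b_1_acac:
  "splits t1_b_1_acac ta_c_1_b ta_c_d_ada [0] [0,1,2,2,1,0,3,2,1] []"
  "splits t1_b_1_acac ta_d_c_ada ta_d_b_c [0,1,0,3,2,4] [0,1,0,2,1,3,3] [3]"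
  "splits t1_b_1_acac ta_b_b_c ta_b_b_c [0,1,2,3] [0,1,0,3,2,1,0,3,2,4] []"
  by (simp_all add: splits_def numeral_eq_Suc Let_def comm_def pr_def zero_kls_def)

lemma splits_t1_1_1_b:
  "splits t1_1_1_b ta_1_1_c ta_1_1_c [3,2,4,3] [3,2,1,0,0,0,4,3,2,1] []"
  "splits t1_1_1_b ta_1_c_aca ta_1_c_aca [2,4,3] [2,1,0,3,4,3,2,1] []"
  "splits t1_1_1_b t1_c_1_aca ta_1_1_acac [] [1,2] [0,1,3,2,4,3]"
  "splits t1_1_1_b ta_1_1_acac t1_c_1_aca [1,2] [] [0,1,3,2,4,3]"
  by (simp_all add: splits_def numeral_eq_Suc Let_def comm_def pr_def zero_kls_def)

lemma splits_t1_c_1_aca: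
  "splits t1_c_1_aca ta_1_1_d ta_1_1_d [1,0] [1,0,3,2,1,3,4,3,2,3] []"
  "splits t1_c_1_aca ta_b_b_c ta_b_b_c [0,1,0,2,3,2] [1,0,4,3,2,1,3,4] []"
  by (simp_all add: splits_def numeral_eq_Suc Let_def comm_def pr_def zero_kls_def)

text \<open>Since b is central modulo K, conjugation by b changes nothing, and c and d share their
  moves.\<close>

lemma conj_ta_b_b_c:
  "tws [1,2,3,4,4,3,2,1] (map (\<lambda>x. - ka + x + ka) ta_b_b_c) = ta_b_b_c"
  "tws [] (map (\<lambda>x. - kb + x + kb) ta_b_b_c) = ta_b_b_c"
  "tws [3,2,1,0,0,1,2,3] (map (\<lambda>x. - kc + x + kc) ta_b_b_c) = ta_b_b_c"
  "tws [3,2,1,0,0,1,2,3] (map (\<lambda>x. - kd + x + kd) ta_b_b_c) = ta_b_b_c"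
  by (simp_all add: numeral_eq_Suc Let_def zero_kls_def)

lemma conj_ta_b_1_c:
  "tws [1,2,3,4,4,3,2,1] (map (\<lambda>x. - ka + x + ka) ta_b_1_c) = ta_b_1_c"
  "tws [] (map (\<lambda>x. - kb + x + kb) ta_b_1_c) = ta_b_1_c"
  "tws [3,2,1,0,0,1,2,3] (map (\<lambda>x. - kc + x + kc) ta_b_1_c) = ta_b_1_c"
  "tws [3,2,1,0,0,1,2,3] (map (\<lambda>x. - kd + x + kd) ta_b_1_c) = ta_b_1_c"
  by (simp_all add: numeral_eq_Suc Let_def zero_kls_def)

section \<open>The descent\<close>

definition weight :: "word \<Rightarrow> nat" where "weight w = length (filter (\<lambda>x. x \<noteq> GA) w)"

lemma weight_simps [simp]:
  "weight [] = 0" "weight (x # w) = (if x = GA then weight w else Suc (weight w))"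
  "weight (u @ v) = weight u + weight v"
  by (simp_all add: weight_def)

text \<open>Each of b, c, d contributes one letter other than a to exactly one of the two states.
  Hence h2 h1 is never heavier than h.\<close>

lemma weight_st: "weight (st w False) + weight (st w True) = weight w"
proof (induction w)
  case (Cons x w) then show ?case by (cases x) simp_all
qed simp

lemma gclass_cancel: "gclass x + (gclass x + c) = c" "gclass x + gclass x = 0"
  using add_minus_cancels(1)[of "gclass x" c] right_minus[of "gclass x"]
  unfolding gclass_involution .

text \<open>1, b, c and d form a Klein four-group.\<close>

lemma merge_letters:
  assumes "x \<noteq> GA" "y \<noteq> GA"
  obtains w where "E w = E [x, y]" "cl w = cl [x, y]" "weight w \<le> 1"
proof -
  have 1: "gperm GC = gperm GB + gperm GD" by (simp only: gperm_bc)
  have 2: "gperm GB + gperm GC = gperm GD" "gperm GC + gperm GD = gperm GB"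
    unfolding 1 by (simp_all only: gperm_cancel add.assoc add_0_right)
  have "- (gperm GB + gperm GD) = - gperm GC" "- (gperm GB + gperm GC) = - gperm GD"
    "- (gperm GC + gperm GD) = - gperm GB"
    by (simp_all only: gperm_bc 2)
  then have 3: "gperm GD + gperm GB = gperm GC" "gperm GC + gperm GB = gperm GD"
    "gperm GD + gperm GC = gperm GB"
    by (simp_all only: minus_add gperm_involution)
  have "\<exists>w. E w = E [x, y] \<and> cl w = cl [x, y] \<and> weight w \<le> 1"
  proof (cases "x = y")
    case True
    then show ?thesis
      by (intro exI[of _ "[]"]) (cases y; simp add: zero_cls_def)
  next
    case False
    then show ?thesis
      using assms 2 3 gperm_bc
      by (cases x; cases y; simp del: gperm_bc)
        (rule exI[of _ "[GB]"] exI[of _ "[GC]"] exI[of _ "[GD]"];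
          simp add: zero_cls_def del: gperm_bc; fail)+
  qed
  then show ?thesis using that by blast
qed

definition alt :: "word \<Rightarrow> word" where "alt xs = concat (map (\<lambda>x. [GA, x]) xs)"

lemma alt_simps [simp]: "alt [] = []" "alt (x # xs) = GA # x # alt xs" "alt (xs @ ys) = alt xs @ alt ys"
  by (simp_all add: alt_def)

lemma active_alt: "GA \<notin> set xs \<Longrightarrow> active (alt xs) \<longleftrightarrow> odd (length xs)"
  by (induction xs) auto

lemma weight_alt: "GA \<notin> set xs \<Longrightarrow> weight (alt xs) = length xs"
  by (induction xs) auto

lemma word_cases:
  obtains p q where "w = p @ [GA, GA] @ q"
  | p x y q where "w = p @ [x, y] @ q" "x \<noteq> GA" "y \<noteq> GA"
  | xs where "w = alt xs" "GA \<notin> set xs"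
  | xs where "w = alt xs @ [GA]" "GA \<notin> set xs"
  | x xs where "w = x # alt xs" "x \<noteq> GA" "GA \<notin> set xs"
  | x xs where "w = x # alt xs @ [GA]" "x \<noteq> GA" "GA \<notin> set xs"
proof -
  have "(\<exists>p q. w = p @ [GA, GA] @ q) \<or> (\<exists>p x y q. w = p @ [x, y] @ q \<and> x \<noteq> GA \<and> y \<noteq> GA) \<or>
    (\<exists>xs. GA \<notin> set xs \<and> (w = alt xs \<or> w = alt xs @ [GA])) \<or>
    (\<exists>x xs. x \<noteq> GA \<and> GA \<notin> set xs \<and> (w = x # alt xs \<or> w = x # alt xs @ [GA]))"
  proof (induction w)
    case Nil
    have "[] = alt []" by simp
    then show ?case by (metis empty_iff list.set(1))
  next
    case (Cons z w)
    from Cons.IH consider (aa) p q where "w = p @ [GA, GA] @ q"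
      | (bb) p x y q where "w = p @ [x, y] @ q" "x \<noteq> GA" "y \<noteq> GA"
      | (a) xs where "GA \<notin> set xs" "w = alt xs \<or> w = alt xs @ [GA]"
      | (b) x xs where "x \<noteq> GA" "GA \<notin> set xs" "w = x # alt xs \<or> w = x # alt xs @ [GA]"
      by metis
    then show ?case
    proof cases
      case aa
      then have "z # w = (z # p) @ [GA, GA] @ q" by simp
      then show ?thesis by blast
    next
      case bb
      then have "z # w = (z # p) @ [x, y] @ q" by simp
      then show ?thesis using bb by blast
    next
      case a
      show ?thesis
      proof (cases "z = GA")
        case False
        then show ?thesis using a by blast
      next
        case True
        show ?thesis
        proof (cases "w = []")
          case True
          then have "z # w = alt [] @ [GA]" using \<open>z = GA\<close> by simp
          then show ?thesis by (metis empty_iff list.set(1))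
        next
          case False
          then obtain v where "w = GA # v" using a by (cases xs) auto
          then have "z # w = [] @ [GA, GA] @ v" using \<open>z = GA\<close> by simp
          then show ?thesis by blast
        qed
      qed
    next
      case b
      show ?thesis
      proof (cases "z = GA")
        case False
        obtain v where "w = x # v" using b by auto
        then have "z # w = [] @ [z, x] @ v" by simp
        then show ?thesis using False b by blast
      next
        case True
        then have "z # w = alt (x # xs) \<or> z # w = alt (x # xs) @ [GA]" "GA \<notin> set (x # xs)"
          using b by auto
        then show ?thesis by metis
      qed
    qed
  qed
  then show ?thesis using that by metis
qed

text \<open>The class of \<open>(a b)\<^sup>2\<close>, the nontrivial element of \<open>K/M\<close>.\<close>

abbreviation "\<beta> \<equiv> Cls False False False True False"

lemma cl_conj_\<beta>: "- x + \<beta> + x = \<beta>"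
  by (cases x) auto

text \<open>Each of the two systems reduces to the other one, so the induction has to carry
  both.\<close>

definition solvable :: "word \<Rightarrow> bool" where
  "solvable w \<longleftrightarrow> Sol ta_b_b_c (E w) \<and> Sol ta_b_1_c (E w)"

lemma solvable_conj: "solvable w \<Longrightarrow> solvable (rev g @ w @ g)"
proof (induction g rule: rev_induct)
  case (snoc x g)
  have "kl [GA] = ka" "kl [GB] = kb" "kl [GC] = kc" "kl [GD] = kd" by (simp_all add: zero_kls_def)
  then have "\<exists>p. tws p (map (\<lambda>y. - kl [x] + y + kl [x]) ta_b_b_c) = ta_b_b_c"
    "\<exists>p. tws p (map (\<lambda>y. - kl [x] + y + kl [x]) ta_b_1_c) = ta_b_1_c"
    using conj_ta_b_b_c conj_ta_b_1_c by (cases x; simp only:; blast)+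
  then have "solvable (rev [x] @ (rev g @ w @ g) @ [x])"
    using snoc Sol_conj_tws[of _ "rev g @ w @ g" _ "[x]"] unfolding solvable_def by blast
  then show ?case by simp
qed simp

lemma solvable_cong: "solvable v \<Longrightarrow> E w = E (rev g @ v @ g) \<Longrightarrow> solvable w"
  using solvable_conj[of v g] by (simp add: solvable_def)

lemma states_\<beta>:
  assumes "cl w = \<beta>"
  shows "\<not> active w"
    "kl (st w False) = kac \<and> kl (st w True) = kca \<or> kl (st w False) = kca \<and> kl (st w True) = kac"
proof -
  show a: "\<not> active w" by (simp add: active_cl assms)
  show "kl (st w False) = kac \<and> kl (st w True) = kca \<or> kl (st w False) = kca \<and> kl (st w True) = kac"
    using class_states[of w] a assms
    by (cases "kl (st w False)"; cases "kl (st w True)") auto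
qed

lemma solvable_step:
  assumes "cl w = \<beta>" "x = [] \<or> x = [GB]" "solvable (rev x @ st w True @ x @ st w False)"
  shows "solvable w"
proof -
  have x: "kl x = 0 \<or> kl x = kb" using assms(2) by (auto simp: zero_kls_def)
  have "\<exists>p p'. merges ta_b_b_c (kl (st w False)) (kl (st w True)) (kl x) ta_b_1_c p p'"
    "\<exists>p p'. merges ta_b_1_c (kl (st w False)) (kl (st w True)) (kl x) ta_b_b_c p p'"
    using states_\<beta>(2)[OF assms(1)] x merges_ta_b_b_c merges_ta_b_1_c
    by (elim disjE conjE; simp only:; blast)+
  then show ?thesis
    using Sol_merge[OF _ states_\<beta>(1)[OF assms(1)], of _ x] assms(3) unfolding solvable_def by blast
qed

text \<open>The product of the states lies in K. Conjugating h2 by b changes it by a commutator of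
  class \<open>\<beta>\<close>, because h2 contains an odd number of letters a; so one of the two
  conjugators leads out of M.\<close>

lemma class_step:
  assumes "cl w = \<beta>"
  shows "cl (st w True @ st w False) = \<beta> \<or> cl ([GB] @ st w True @ [GB] @ st w False) = \<beta>"
  using states_\<beta>(2)[OF assms] unfolding kl_def
  by (cases "cl (st w False)"; cases "cl (st w True)") (auto simp: zero_cls_def)

context
  fixes n :: nat
  assumes IH: "\<And>w. cl w = \<beta> \<Longrightarrow> weight w < n \<Longrightarrow> solvable w"
begin

lemma solvable_less:
  assumes "cl w = \<beta>" "E v = E w" "cl v = cl w" "weight v < n"
  shows "solvable w"
  using IH[of v] assms by (simp add: solvable_def)

text \<open>The word \<open>h\<^sub>2\<^sup>x h\<^sub>1\<close> always gets shorter for \<open>x = 1\<close>. For \<open>x = b\<close> it does if the first letter is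
  \<open>d\<close>, whose trivial state lets two letters merge, or if the outer letters are \<open>b\<close> and \<open>c\<close>, whose
  states \<open>c\<close> and \<open>d\<close> cancel against \<open>b\<close>. Every cyclic word can be rotated into one of these forms,
  except the powers of \<open>a b\<close> and \<open>a c\<close>.\<close>

lemma solvable_alt_ends:
  assumes cl: "cl (alt (x # ys @ [z])) = \<beta>" and n: "length ys + 2 = n" and A: "GA \<notin> set (x # ys @ [z])"
    and d: "x = GD \<or> x \<noteq> z \<and> z \<noteq> GD"
  shows "solvable (alt (x # ys @ [z]))"
proof -
  let ?w = "alt (x # ys @ [z])"
  have ev: "even (length ys)"
    using states_\<beta>(1)[OF cl] active_alt[OF A] by simp
  obtain x' where x': "st (x # u) True = x' # st u True" "x' \<noteq> GA" "active [x] = False" for u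
    using A by (cases x) auto
  obtain z' where z': "st [z] True = [z']" "z' \<noteq> GA" using A by (cases z) auto
  have ay: "active (alt ys) = False" using ev A active_alt[of ys] by simp
  define v where "v = st (alt (ys @ [z])) True"
  define u where "u = st (GA # x # alt ys) True"
  have 1: "st ?w False = x' # v" using x' by (simp add: v_def)
  have 2: "st ?w True = u @ [z']"
    using st_append[of "GA # x # alt ys" "[GA, z]" True] ay z' x'(3) by (simp add: u_def)
  have w: "weight u + weight v + 2 = n"
    using weight_st[of ?w] weight_alt[OF A] n x'(2) z'(2) unfolding 1 2 by simp
  show ?thesis
  proof (cases "cl (st ?w True @ st ?w False) = \<beta>")
    case True
    obtain m where m: "E m = E [z', x']" "cl m = cl [z', x']" "weight m \<le> 1"
      using z'(2) x'(2) by (rule merge_letters)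
    have "solvable (st ?w True @ st ?w False)"
    proof (rule solvable_less[OF True, of "u @ m @ v"])
      show "E (u @ m @ v) = E (st ?w True @ st ?w False)"
        using m(1) unfolding 1 2 by (simp add: add.assoc[symmetric])
      show "cl (u @ m @ v) = cl (st ?w True @ st ?w False)"
        using m(2) unfolding 1 2 by (simp add: add.assoc)
      show "weight (u @ m @ v) < n" using w m(3) by simp
    qed
    then show ?thesis using solvable_step[OF cl, of "[]"] by simp
  next
    case False
    then have cl': "cl ([GB] @ st ?w True @ [GB] @ st ?w False) = \<beta>" using class_step[OF cl] by blast
    have "solvable ([GB] @ st ?w True @ [GB] @ st ?w False)"
    proof (cases "x = GD")
      case True
      have x'': "x' = GB" using x'(1)[of "[]"] True by simp
      obtain y r where yr: "ys @ [z] = y # r" by (cases "ys @ [z]") auto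
      then have "y \<in> set (ys @ [z])" by simp
      then have "y \<noteq> GA" using A by auto
      then obtain y' where y': "st (y # t) True = y' # st t True" "y' \<noteq> GA" for t
        by (cases y) auto
      define s where "s = st (alt r) True"
      have "st ?w True = y' # s" using True yr y' by (simp add: s_def)
      then have us: "u @ [z'] = y' # s" using 2 by simp
      have ws: "weight s = weight u"
        using arg_cong[OF us, of weight] y'(2) z'(2) by simp
      have "GB \<noteq> GA" by simp
      then obtain m where m: "E m = E [GB, y']" "cl m = cl [GB, y']" "weight m \<le> 1"
        using y'(2) by (rule merge_letters)
      have e: "[GB] @ st ?w True @ [GB] @ st ?w False = [GB, y'] @ s @ [GB, GB] @ v"
        unfolding 1 2 us x'' by simp
      \<comment> \<open>Conjugation by b has added two letters. The state b of the leading d cancels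
        one of them together with itself, and the other merges with y', so one letter is saved in
        total.\<close>
      have "solvable ([GB, y'] @ s @ [GB, GB] @ v)"
      proof (rule solvable_less[of _ "m @ s @ v"])
        show "E (m @ s @ v) = E ([GB, y'] @ s @ [GB, GB] @ v)"
          using m(1) by (simp add: add.assoc)
        show "cl (m @ s @ v) = cl ([GB, y'] @ s @ [GB, GB] @ v)"
          using m(2) by (simp add: add.assoc gclass_cancel del: gclass.simps)
        show "weight (m @ s @ v) < n" using w ws m(3) by simp
      qed (rule cl'[unfolded e])
      then show ?thesis unfolding e .
    next
      case False
      then have xz: "x' = GC \<and> z' = GD \<or> x' = GD \<and> z' = GC"
        using d A x'(1)[of "[]"] z'(1) by (cases x; cases z) auto
      have e: "[GB] @ st ?w True @ [GB] @ st ?w False = [GB] @ u @ [z', GB, x'] @ v"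
        unfolding 1 2 by simp
      have 3: "E [z', GB, x'] = 0" "cl [z', GB, x'] = 0"
      proof -
        have "gperm GB + gperm GC = gperm GD"
          using gperm_cancel(1)[of GB "gperm GD"] by simp
        then show "E [z', GB, x'] = 0" using xz by (elim disjE conjE) (simp_all)
        show "cl [z', GB, x'] = 0" using xz by (auto simp: zero_cls_def)
      qed
      have "E ([GB] @ u @ v) = E ([GB] @ u @ [z', GB, x'] @ v)"
        "cl ([GB] @ u @ v) = cl ([GB] @ u @ [z', GB, x'] @ v)"
        unfolding E_simps(3) cl_simps(3) 3 by simp_all
      then have "solvable ([GB] @ u @ [z', GB, x'] @ v)"
        by (rule solvable_less[OF cl'[unfolded e]]) (use w in simp)
      then show ?thesis unfolding e .
    qed
    then show ?thesis using solvable_step[OF cl, of "[GB]"] by simp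
  qed
qed

text \<open>Rotating is conjugating, and the class \<open>\<beta>\<close> is central.\<close>

lemma solvable_alt_rotate:
  assumes "cl (alt (p @ q)) = \<beta>" "cl (alt (q @ p)) = \<beta> \<Longrightarrow> solvable (alt (q @ p))"
  shows "solvable (alt (p @ q))"
proof -
  have "cl (alt (q @ p)) = - cl (alt p) + cl (alt (p @ q)) + cl (alt p)"
    unfolding alt_simps cl_simps(3) by (simp only: add_minus_cancels add.assoc)
  then have "cl (alt (q @ p)) = \<beta>" unfolding assms(1) cl_conj_\<beta> .
  then have "solvable (alt (q @ p))" by (rule assms(2))
  then show ?thesis
    by (rule solvable_cong[of _ _ "rev (alt p)"])
      (simp only: alt_simps(3) E_simps(3) rev_rev_ident E_rev add.assoc right_minus add_0_right)
qed

lemma change_position: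
  assumes "u \<in> set xs" "v \<in> set xs" "u \<noteq> v"
  shows "\<exists>p x y q. xs = p @ [x, y] @ q \<and> x \<noteq> y"
  using assms
proof (induction xs arbitrary: u v)
  case (Cons z xs)
  show ?case
  proof (cases xs)
    case Nil
    then show ?thesis using Cons.prems by auto
  next
    case (Cons z' xs')
    show ?thesis
    proof (cases "z = z'")
      case True
      then have "u \<in> set xs" "v \<in> set xs" using Cons.prems \<open>xs = z' # xs'\<close> by auto
      then obtain p x y q where "xs = p @ [x, y] @ q" "x \<noteq> y" using Cons.IH Cons.prems by metis
      then have "z # xs = (z # p) @ [x, y] @ q" by simp
      then show ?thesis using \<open>x \<noteq> y\<close> by blast
    next
      case False
      then have "z # xs = [] @ [z, z'] @ xs'" using \<open>xs = z' # xs'\<close> by simp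
      then show ?thesis using False by blast
    qed
  qed
qed simp

lemma rev_alt_replicate: "rev (x # alt (replicate m x)) = x # alt (replicate m x)"
proof -
  have "rev (alt (replicate m x)) @ [x] = x # alt (replicate m x)"
  proof (induction m)
    case (Suc m)
    have "alt (replicate (Suc m) x) = alt (replicate m x) @ [GA, x]"
      by (simp add: replicate_append_same[symmetric] del: replicate_append_same)
    then show ?case using Suc by simp
  qed simp
  then show ?thesis by simp
qed

text \<open>Even powers of a c never have class \<open>\<beta>\<close>, so among the words that
  cannot be shortened only powers of a b remain.\<close>

lemma cl_alt_replicate:
  "cl (alt (replicate (2 * k) GB)) = (if odd k then \<beta> else 0)"
  "cl (alt (replicate (2 * k) GC)) = (if odd k then Cls False False False True True else 0)"
  by (induction k) (simp_all add: zero_cls_def)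

text \<open>For odd k, (a b)^(2k) = a y a y with the palindrome y = b (a b)^(k-1). As y is an
  involution, this is [a,y], and y has the class of b. A second commutator is added for free, [b,c]
  = 1 or [1,c] = 1.\<close>

lemma solvable_alt_replicate:
  assumes "odd k"
  shows "solvable (alt (replicate (2 * k) GB))"
proof -
  define y where "y = GB # alt (replicate (k - 1) GB)"
  have k: "replicate k GB = GB # replicate (k - 1) GB" using assms by (cases k) auto
  have "alt (replicate (2 * k) GB) = GA # y @ GA # y"
    by (simp add: y_def mult_2 replicate_add k)
  moreover have "rev y = y" by (simp only: y_def rev_alt_replicate)
  then have "- E y = E y" using E_rev[of y] by simp
  ultimately have 1: "E (alt (replicate (2 * k) GB)) = comm (E [GA]) (E y)"
    by (simp add: comm_def diff_plus add.assoc del: add_uminus_conv_diff)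
  obtain j where "k - 1 = 2 * j" using assms by (auto elim: oddE)
  then have "kl (alt (replicate (k - 1) GB)) = 0"
    by (simp add: kl_def cl_alt_replicate zero_kls_def zero_cls_def)
  then have "kl y = kb" by (simp add: y_def)
  then have G: "(E [GA], ka) \<in> Gam" "(E y, kb) \<in> Gam" "(E [GB], kb) \<in> Gam" "(E [GC], kc) \<in> Gam"
    "(0, 0) \<in> Gam"
    using Gam_word[of "[GA]"] Gam_word[of y] Gam_word[of "[GB]"] Gam_word[of "[GC]"] Gam_word[of "[]"]
    by (simp_all add: zero_kls_def)
  have bc: "gperm GB + gperm GC = gperm GD" using gperm_cancel(1)[of GB "gperm GD"] by simp
  have "gperm GB + (gperm GC + (gperm GB + gperm GC)) = (gperm GB + gperm GC) + (gperm GB + gperm GC)"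
    by (simp only: add.assoc)
  also have "\<dots> = 0" by (simp only: bc gperm_cancel)
  finally have bcbc: "gperm GB + (gperm GC + (gperm GB + gperm GC)) = 0" .
  from bcbc have 2: "comm (E [GB]) (E [GC]) = 0" "comm 0 (E [GC]) = 0"
    by (simp_all add: comm_def diff_plus add.assoc del: add_uminus_conv_diff)
  show ?thesis
    using Sol_4I[OF G(1,2,3,4)] Sol_4I[OF G(1,2,5,4)] unfolding solvable_def 1 2 by simp
qed

lemma solvable_alt:
  assumes cl: "cl (alt xs) = \<beta>" and n: "length xs = n" and A: "GA \<notin> set xs"
  shows "solvable (alt xs)"
proof (cases "GD \<in> set xs")
  case True
  then obtain p q where pq: "xs = p @ GD # q" by (auto dest: split_list)
  have "q @ p \<noteq> []"
  proof
    assume "q @ p = []"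
    then show False using cl pq by simp
  qed
  then obtain ys z where yz: "q @ p = ys @ [z]" by (cases "q @ p" rule: rev_cases) auto
  have "solvable (alt (p @ (GD # q)))"
  proof (rule solvable_alt_rotate)
    assume c: "cl (alt ((GD # q) @ p)) = \<beta>"
    have e: "(GD # q) @ p = GD # ys @ [z]" using yz by simp
    have s: "set xs = set (GD # ys @ [z])" "length xs = length (GD # ys @ [z])"
      using pq arg_cong[OF yz, of set] arg_cong[OF yz, of length] by auto
    show "solvable (alt ((GD # q) @ p))"
      using c unfolding e by (rule solvable_alt_ends) (use s n A in auto)
  qed (use cl pq in simp)
  then show ?thesis using pq by simp
next
  case False
  show ?thesis
  proof (cases "GB \<in> set xs \<and> GC \<in> set xs")
    case True
    then obtain p x y q where pq: "xs = p @ [x, y] @ q" "x \<noteq> y"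
      using change_position[of GB xs GC] by blast
    have "solvable (alt ((p @ [x]) @ (y # q)))"
    proof (rule solvable_alt_rotate)
      assume c: "cl (alt ((y # q) @ (p @ [x]))) = \<beta>"
      have e: "(y # q) @ (p @ [x]) = y # (q @ p) @ [x]" by simp
      show "solvable (alt ((y # q) @ (p @ [x])))"
        using c unfolding e by (rule solvable_alt_ends) (use pq n A False in auto)
    qed (use cl pq in simp)
    then show ?thesis using pq by simp
  next
    case c: False
    have "\<exists>x \<in> {GB, GC}. \<forall>y \<in> set xs. y = x"
    proof -
      have "y = GB \<or> y = GC" if "y \<in> set xs" for y
      proof -
        have "y \<noteq> GA" "y \<noteq> GD" using that False A by auto
        then show ?thesis by (cases y) auto
      qed
      then show ?thesis using c by blast
    qed
    then obtain x where x: "x = GB \<or> x = GC" "xs = replicate n x"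
      using n by (metis insertE replicate_length_same singletonD)
    have "even n" using states_\<beta>(1)[OF cl] active_alt[OF A] n by simp
    then obtain k where k: "n = 2 * k" by (elim evenE)
    have "x = GB \<and> odd k"
      using cl x cl_alt_replicate[of k] unfolding k by (auto simp: zero_cls_def split: if_splits)
    then show ?thesis using solvable_alt_replicate x k by simp
  qed
qed

end

text \<open>The length is the second component of the order because deleting a a, or conjugating by
  a to remove the outer letters a, leaves the weight unchanged.\<close>

lemma solvable_\<beta>: "cl w = \<beta> \<Longrightarrow> solvable w"
proof (induction "(weight w, length w)" arbitrary: w rule: wf_induct_rule[OF wf_lex_prod[OF wf_less_than wf_less_than]])
  case (1 w)
  have IH: "solvable v" if "cl v = \<beta>" "weight v < weight w \<or> weight v = weight w \<and> length v < length w" for v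
    using 1 that by auto
  have less: "solvable v" if "cl v = \<beta>" "weight v < weight w" for v
    using IH that by blast
  have conj: "solvable w"
    if "E w = E (rev g @ v @ g)" "cl v = - cl h + cl w + cl h"
      "weight v < weight w \<or> weight v = weight w \<and> length v < length w" for g v h
  proof -
    have "cl v = \<beta>" using that(2) unfolding 1(2) cl_conj_\<beta> .
    then show ?thesis using IH that(3) by (intro solvable_cong[OF _ that(1)]) blast
  qed
  have one: "solvable w" if "w = [x]" for x
    using 1(2) that by (cases x) simp_all
  show ?case
  proof (cases w rule: word_cases)
    case (1 p q)
    show ?thesis
      by (intro conj[of "[]" "p @ q" "[]"]) (simp_all add: 1 gclass_cancel del: gclass.simps)
  next
    case (2 p x y q)
    obtain m where m: "E m = E [x, y]" "cl m = cl [x, y]" "weight m \<le> 1"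
      using 2(2,3) by (rule merge_letters)
    show ?thesis
      by (rule conj[of "[]" "p @ m @ q" "[]"]) (use m 2 in \<open>simp_all add: add.assoc\<close>)
  next
    case (3 xs)
    show ?thesis
      using solvable_alt[OF less _ _ 3(2)] 1(2) weight_alt[OF 3(2)] unfolding 3(1) by simp
  next
    case (4 xs)
    show ?thesis
    proof (cases xs)
      case Nil then show ?thesis using one 4 by simp
    next
      case (Cons x ys)
      show ?thesis
        by (rule conj[of "[GA]" "x # alt ys" "[GA]"]) (use 4 Cons in \<open>simp_all add: add.assoc gclass_cancel del: gclass.simps\<close>)
    qed
  next
    case (5 x xs)
    show ?thesis
    proof (cases xs rule: rev_cases)
      case Nil then show ?thesis using one 5 by simp
    next
      case (snoc ys y)
      have "y \<noteq> GA" using 5 snoc by auto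
      then obtain m where m: "E m = E [y, x]" "cl m = cl [y, x]" "weight m \<le> 1"
        using 5(2) by (rule merge_letters)
      show ?thesis
        by (rule conj[of "[x]" "alt ys @ [GA] @ m" "[x]"])
          (use m 5 snoc \<open>y \<noteq> GA\<close> in \<open>simp_all add: add.assoc gclass_cancel del: gclass.simps\<close>)
    qed
  next
    case (6 x xs)
    have "cl (alt (xs @ [x])) = - cl [x] + cl w + cl [x]"
      unfolding 6(1) by (simp add: add.assoc gclass_cancel del: gclass.simps)
    then have c: "cl (alt (xs @ [x])) = \<beta>" unfolding 1(2) cl_conj_\<beta> .
    have "solvable (alt (xs @ [x]))"
      by (rule solvable_alt[where n = "weight w", OF _ c]) (use less 6 weight_alt[OF 6(3)] in auto)
    then show ?thesis
      by (rule solvable_cong[of _ _ "[x]"]) (simp add: 6 add.assoc)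
  qed
qed

section \<open>Elements of \<open>K\<close> as products of two commutators\<close>

text \<open>The classes of \<open>(a c)\<^sup>2\<close> and \<open>(a d)\<^sup>2\<close>.\<close>

abbreviation "\<gamma> \<equiv> Cls False False False True True"
abbreviation "\<delta> \<equiv> Cls False False False False True"

lemma Sol_by_merge:
  assumes "Sol t' (E (rev x @ st w True @ x @ st w False))" "\<not> active w"
    "\<exists>p p'. merges t (kl (st w False)) (kl (st w True)) (kl x) t' p p'"
  shows "Sol t (E w)"
  using assms Sol_merge by blast

lemma choose_conjugator:
  assumes "P (u @ v) \<or> P ([GB] @ u @ [GB] @ v)"
  shows "\<exists>x. (x = [] \<or> x = [GB]) \<and> P (rev x @ u @ x @ v)"
  using assms
proof
  assume "P (u @ v)"
  then show ?thesis by (intro exI[of _ "[]"]) simp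
next
  assume "P ([GB] @ u @ [GB] @ v)"
  then show ?thesis by (intro exI[of _ "[GB]"]) simp
qed

lemma kl_letters: "kl [] = 0" "kl [GA] = ka" "kl [GB] = kb"
  by (simp_all add: zero_kls_def)

lemma Sol_ac_b_1_1:
  assumes "cl w = \<beta>"
  shows "Sol tac_b_1_1 (E w)"
proof -
  obtain x where x: "x = [] \<or> x = [GB]" "cl (rev x @ st w True @ x @ st w False) = \<beta>"
    using choose_conjugator[OF class_step[OF assms]] by (elim exE conjE)
  show ?thesis
  proof (rule Sol_by_merge)
    show "Sol ta_b_1_c (E (rev x @ st w True @ x @ st w False))"
      using solvable_\<beta>[OF x(2)] by (simp add: solvable_def)
    show "\<exists>p p'. merges tac_b_1_1 (kl (st w False)) (kl (st w True)) (kl x) ta_b_1_c p p'"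
      using states_\<beta>(2)[OF assms] x(1) merges_tac_b_1_1
      by (elim disjE conjE; simp only: kl_letters; blast)
  qed (rule states_\<beta>(1)[OF assms])
qed

text \<open>Elements of class \<open>\<gamma>\<close> lie outside K, but they occur as states of
  elements of M.\<close>

lemma Sol_\<gamma>:
  assumes "cl w = \<gamma>"
  shows "Sol ta_c_1_b (E w)" "Sol ta_c_d_ada (E w)"
proof -
  have a: "\<not> active w" by (simp add: active_cl assms)
  have k: "kl (st w False) = kad \<and> kl (st w True) = kda \<or> kl (st w False) = kda \<and> kl (st w True) = kad"
    using class_states[of w] a assms
    by (cases "kl (st w False)"; cases "kl (st w True)") auto
  then have "cl (st w True @ st w False) = \<beta> \<or> cl ([GB] @ st w True @ [GB] @ st w False) = \<beta>"
    unfolding kl_def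
    by (cases "cl (st w False)"; cases "cl (st w True)") (auto simp: zero_cls_def)
  from choose_conjugator[OF this]
  obtain x where x: "x = [] \<or> x = [GB]" "cl (rev x @ st w True @ x @ st w False) = \<beta>"
    by (elim exE conjE)
  have S: "Sol ta_b_b_c (E (rev x @ st w True @ x @ st w False))"
    using solvable_\<beta>[OF x(2)] by (simp add: solvable_def)
  show "Sol ta_c_1_b (E w)"
    using k x(1) merges_ta_c_1_b
    by (intro Sol_by_merge[OF S a]) (elim disjE conjE; simp only: kl_letters; blast)
  show "Sol ta_c_d_ada (E w)"
    using k x(1) merges_ta_c_d_ada
    by (intro Sol_by_merge[OF S a]) (elim disjE conjE; simp only: kl_letters; blast)
qed

text \<open>For such elements of \<open>M\<close> the product of the states lies in the class \<open>\<beta>\<close>.\<close>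

definition mixed :: "word \<Rightarrow> bool" where
  "mixed w \<longleftrightarrow> cl w = 0 \<and> cl (st w False) \<noteq> cl (st w True)"

lemma states_0:
  assumes "cl w = 0"
  shows "\<not> active w" "\<exists>n. kl (st w False) = Kls False False False n \<and> kl (st w True) = Kls False False False n"
proof -
  show a: "\<not> active w" by (simp add: active_cl assms zero_cls_def)
  show "\<exists>n. kl (st w False) = Kls False False False n \<and> kl (st w True) = Kls False False False n"
    using class_states[of w] a assms
    by (cases "kl (st w False)"; cases "kl (st w True)") (auto simp: zero_cls_def)
qed

lemma Sol_mixed:
  assumes "mixed w"
  shows "Sol ta_1_b_c (E w)" "Sol tac_1_1_b (E w)" "Sol ta_1_1_c (E w)" "Sol ta_1_c_aca (E w)"
    "Sol ta_1_1_d (E w)"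
proof -
  note w = assms[unfolded mixed_def]
  obtain n where n: "kl (st w False) = Kls False False False n" "kl (st w True) = Kls False False False n"
    using states_0(2) w by blast
  have k: "kl (st w False) = 0 \<and> kl (st w True) = 0 \<or> kl (st w False) = kacac \<and> kl (st w True) = kacac"
    using n by (cases n) (simp_all add: zero_kls_def)
  have c: "cl (st w True @ st w False) = \<beta>"
    using n w unfolding kl_def by (cases "cl (st w False)"; cases "cl (st w True)") auto
  have S: "Sol ta_b_b_c (E (rev [] @ st w True @ [] @ st w False))"
    "Sol ta_b_1_c (E (rev [] @ st w True @ [] @ st w False))"
    "Sol tac_b_1_1 (E (rev [] @ st w True @ [] @ st w False))"
    using solvable_\<beta>[OF c] Sol_ac_b_1_1[OF c] by (simp_all add: solvable_def)
  have a: "\<not> active w" using states_0(1) w by blast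
  show "Sol ta_1_b_c (E w)"
    using k merges_ta_1_b_c
    by (intro Sol_by_merge[OF S(2) a]) (elim disjE conjE; simp only: kl_letters; blast)
  show "Sol tac_1_1_b (E w)"
    using k merges_tac_1_1_b
    by (intro Sol_by_merge[OF S(1) a]) (elim disjE conjE; simp only: kl_letters; blast)
  show "Sol ta_1_1_c (E w)"
    using k merges_ta_1_1_c
    by (intro Sol_by_merge[OF S(1) a]) (elim disjE conjE; simp only: kl_letters; blast)
  show "Sol ta_1_c_aca (E w)"
    using k merges_ta_1_c_aca
    by (intro Sol_by_merge[OF S(1) a]) (elim disjE conjE; simp only: kl_letters; blast)
  show "Sol ta_1_1_d (E w)"
    using k merges_ta_1_1_d
    by (intro Sol_by_merge[OF S(3) a]) (elim disjE conjE; simp only: kl_letters; blast)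
qed

lemma states_n:
  assumes "cl u = Cls False j False m True"
  shows "\<not> active u" "\<exists>p q n. cl (st u False) = Cls (m \<noteq> j) (\<not> m) m p n \<and>
    cl (st u True) = Cls m (m = j) (m \<noteq> j) q (n \<noteq> ((m \<noteq> j) \<and> m))"
proof -
  show a: "\<not> active u" by (simp add: active_cl assms)
  obtain i0 j0 k0 m0 n0 where 0: "cl (st u False) = Cls i0 j0 k0 m0 n0" by (cases "cl (st u False)")
  obtain i1 j1 k1 m1 n1 where 1: "cl (st u True) = Cls i1 j1 k1 m1 n1" by (cases "cl (st u True)")
  have "i1 = k0" "k1 = i0" "n1 = (n0 \<noteq> (i0 \<and> k0))"
    "(i0 \<noteq> k0) = j" "((i0 \<noteq> j0) \<noteq> (k0 \<noteq> j1)) = False" "k0 = m" "(j0 \<noteq> k0) = True"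
    using class_states[of u] a assms by (auto simp: kl_def 0 1)
  then show "\<exists>p q n. cl (st u False) = Cls (m \<noteq> j) (\<not> m) m p n \<and>
    cl (st u True) = Cls m (m = j) (m \<noteq> j) q (n \<noteq> ((m \<noteq> j) \<and> m))"
    unfolding 0 1 by auto
qed

text \<open>As b = <<a,c>>, replacing u by its conjugate under b multiplies the classes of the two
  states by those of their commutators with a and with c. These two factors always differ by
  \<open>\<beta>\<close>, so exactly one of the two products has states of different
  classes.\<close>

lemma mixed_choice:
  assumes u: "cl u = Cls False j False m True" and v: "cl v = Cls False j False m True"
  shows "mixed (u @ v) \<or> mixed ([GB] @ u @ [GB] @ v)"
proof -
  have 0: "cl (u @ v) = 0" "cl ([GB] @ u @ [GB] @ v) = 0"
    by (simp_all add: u v zero_cls_def)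
  obtain p q n where su: "cl (st u False) = Cls (m \<noteq> j) (\<not> m) m p n"
    "cl (st u True) = Cls m (m = j) (m \<noteq> j) q (n \<noteq> ((m \<noteq> j) \<and> m))"
    using states_n(2)[OF u] by (elim exE conjE)
  obtain p' q' n' where sv: "cl (st v False) = Cls (m \<noteq> j) (\<not> m) m p' n'"
    "cl (st v True) = Cls m (m = j) (m \<noteq> j) q' (n' \<noteq> ((m \<noteq> j) \<and> m))"
    using states_n(2)[OF v] by (elim exE conjE)
  have a: "active u = False" "active v = False" using states_n(1) u v by auto
  have 1: "cl (st (u @ v) i) = cl (st u i) + cl (st v i)"
    "cl (st ([GB] @ u @ [GB] @ v) i) =
     gclass (if i then GC else GA) + (cl (st u i) + (gclass (if i then GC else GA) + cl (st v i)))" for i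
    by (simp_all add: a)
  show ?thesis
    unfolding mixed_def 0 1 su sv by (cases m; cases j) auto
qed

text \<open>If the states differ modulo M, their product has class \<open>\<beta>\<close>. If they
  agree, it lies in M: for states of class b modulo K, conjugating one of them by a restores class
  \<open>\<beta>\<close>, and otherwise a conjugator from 1 and b makes the product mixed.\<close>

lemma Sol_\<delta>:
  assumes "cl w = \<delta>"
  shows "Sol ta_d_c_ada (E w)" "Sol ta_d_b_c (E w)"
proof -
  have a: "\<not> active w" by (simp add: active_cl assms)
  obtain m1 m2 n where c: "cl (st w False) = Cls False True False m1 n" "cl (st w True) = Cls False True False m2 n"
    using class_states[of w] a assms unfolding kl_def
    by (cases "cl (st w False)"; cases "cl (st w True)") (auto simp: zero_cls_def)
  then have k: "kl (st w False) = Kls False True False n" "kl (st w True) = Kls False True False n"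
    by (simp_all add: kl_def)
  have s: "Sol ta_b_1_c (E (st w True @ st w False))" if "m1 \<noteq> m2"
  proof -
    have "cl (st w True @ st w False) = \<beta>" using c that by auto
    then show ?thesis using solvable_\<beta> unfolding solvable_def by blast
  qed
  have s': "Sol ta_b_b_c (E ([GA] @ st w True @ [GA] @ st w False))" if "m1 = m2" "\<not> n"
  proof -
    have "cl ([GA] @ st w True @ [GA] @ st w False) = \<beta>" using c that by auto
    then show ?thesis using solvable_\<beta> unfolding solvable_def by blast
  qed
  have s'': "Sol ta_1_b_c (E (st w True @ st w False)) \<or> Sol ta_1_b_c (E ([GB] @ st w True @ [GB] @ st w False))"
    if "m1 = m2" n
  proof -
    have "cl (st w True) = Cls False True False m1 True" "cl (st w False) = Cls False True False m1 True"
      using c that by simp_all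
    from mixed_choice[OF this] show ?thesis using Sol_mixed(1) by blast
  qed
  have "\<exists>x t'. Sol t' (E (rev x @ st w True @ x @ st w False)) \<and>
    (\<not> n \<and> x = [] \<and> t' = ta_b_1_c \<or> \<not> n \<and> x = [GA] \<and> t' = ta_b_b_c \<or>
     n \<and> x = [] \<and> t' = ta_b_1_c \<or> n \<and> x = [] \<and> t' = ta_1_b_c \<or> n \<and> x = [GB] \<and> t' = ta_1_b_c)"
  proof (cases "m1 = m2")
    case False
    then show ?thesis using s by (intro exI[of _ "[]"] exI[of _ ta_b_1_c]) simp
  next
    case True
    show ?thesis
    proof (cases n)
      case False
      then show ?thesis using s' True by (intro exI[of _ "[GA]"] exI[of _ ta_b_b_c]) simp
    next
      case n: True
      from s''[OF True n] show ?thesis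
      proof
        assume "Sol ta_1_b_c (E (st w True @ st w False))"
        then show ?thesis using n by (intro exI[of _ "[]"] exI[of _ ta_1_b_c]) simp
      next
        assume "Sol ta_1_b_c (E ([GB] @ st w True @ [GB] @ st w False))"
        then show ?thesis using n by (intro exI[of _ "[GB]"] exI[of _ ta_1_b_c]) simp
      qed
    qed
  qed
  then obtain x t' where S: "Sol t' (E (rev x @ st w True @ x @ st w False))"
    and xt: "\<not> n \<and> x = [] \<and> t' = ta_b_1_c \<or> \<not> n \<and> x = [GA] \<and> t' = ta_b_b_c \<or>
     n \<and> x = [] \<and> t' = ta_b_1_c \<or> n \<and> x = [] \<and> t' = ta_1_b_c \<or> n \<and> x = [GB] \<and> t' = ta_1_b_c"
    by (elim exE conjE)
  have kn: "kl (st w False) = (if n then kacad else kb)" "kl (st w True) = (if n then kacad else kb)"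
    using k by (cases n; simp)+
  show "Sol ta_d_c_ada (E w)"
    using xt kn merges_ta_d_c_ada
    by (intro Sol_by_merge[OF S a]) (elim disjE conjE; simp only: kl_letters if_True if_False not_True_eq_False; blast)
  show "Sol ta_d_b_c (E w)"
    using xt kn merges_ta_d_b_c
    by (intro Sol_by_merge[OF S a]) (elim disjE conjE; simp only: kl_letters if_True if_False not_True_eq_False; blast)
qed

lemma classes_0:
  assumes "cl w = 0"
  shows "mixed w \<or> (\<exists>c\<in>{0, \<beta>, \<gamma>, \<delta>}. cl (st w False) = c \<and> cl (st w True) = c)"
proof -
  obtain n where n: "kl (st w False) = Kls False False False n"
    using states_0(2)[OF assms] by blast
  then have "cl (st w False) \<in> {0, \<beta>, \<gamma>, \<delta>}"
    unfolding kl_def by (cases "cl (st w False)") (auto simp: zero_cls_def)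
  then show ?thesis using assms by (auto simp: mixed_def)
qed

lemma Sol_1_b_1_acac:
  assumes "cl w = 0" "cl (st w False) = c" "cl (st w True) = c" "c \<in> {\<beta>, \<gamma>, \<delta>}"
  shows "Sol t1_b_1_acac (E w)"
proof -
  note a = states_0(1)[OF assms(1)]
  consider "c = \<beta>" | "c = \<gamma>" | "c = \<delta>" using assms(4) by auto
  then show ?thesis
  proof cases
    case 1
    have "solvable (st w False)" "solvable (st w True)"
      by (rule solvable_\<beta>, simp only: assms(2,3) 1)+
    then show ?thesis
      unfolding solvable_def by (elim conjE) (rule Sol_split[OF splits_t1_b_1_acac(3) a])
  next
    case 2
    show ?thesis
      by (rule Sol_split[OF splits_t1_b_1_acac(1) a Sol_\<gamma>(1) Sol_\<gamma>(2)])
        (simp_all only: assms(2,3) 2)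
  next
    case 3
    show ?thesis
      by (rule Sol_split[OF splits_t1_b_1_acac(2) a Sol_\<delta>(1) Sol_\<delta>(2)])
        (simp_all only: assms(2,3) 3)
  qed
qed

lemma Sol_choice:
  assumes "cl w = 0" "cl (st w False) = c" "cl (st w True) = c" "c \<in> {\<gamma>, \<delta>}"
  shows "Sol ta_1_1_d (E w)" "Sol ta_1_1_acac (E w)"
proof -
  note a = states_0(1)[OF assms(1)]
  obtain m where m: "c = Cls False False False m True" using assms(4) by auto
  have "mixed (st w True @ st w False) \<or> mixed ([GB] @ st w True @ [GB] @ st w False)"
    by (rule mixed_choice[of _ False m]) (simp_all only: assms(2,3) m)
  from choose_conjugator[OF this]
  obtain x where x: "x = [] \<or> x = [GB]" and m: "mixed (rev x @ st w True @ x @ st w False)"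
    by (elim exE conjE)
  note S = Sol_mixed(2)[OF m]
  have k: "kl (st w False) = kacac" "kl (st w True) = kacac"
    using assms by (auto simp: kl_def)
  show "Sol ta_1_1_d (E w)"
    using x k merges_ta_1_1_d
    by (intro Sol_by_merge[OF S a]) (elim disjE; simp only: kl_letters; blast)
  show "Sol ta_1_1_acac (E w)"
    using x k merges_ta_1_1_acac
    by (intro Sol_by_merge[OF S a]) (elim disjE; simp only: kl_letters; blast)
qed

lemma Sol_product:
  assumes "cl w = 0" "cl (st w False) = c" "cl (st w True) = c"
    and S: "Sol t' (E (rev [] @ st w True @ [] @ st w False))"
    and m: "\<exists>p p'. merges t (kof c) (kof c) (kl []) t' p p'"
  shows "Sol t (E w)"
  using Sol_by_merge[OF S states_0(1)[OF assms(1)]] m assms(2,3) by (simp add: kl_def)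

lemma cl_product:
  assumes "cl (st w False) = c" "cl (st w True) = c" "c \<in> {0, \<beta>, \<gamma>, \<delta>}"
  shows "cl (st w True @ st w False) = 0"
  using assms by (auto simp: zero_cls_def)

text \<open>In an alternating word the letters other than a pass their weight to the two states in
  turn, so with at least two of them both states are strictly lighter. The shorter nonempty words
  all have nonzero class.\<close>

lemma alternating_word:
  "\<exists>v. E v = E w \<and> cl v = cl w \<and> weight v \<le> weight w \<and>
    (v = [] \<or> (\<forall>i. weight (st v i) < weight v) \<or> weight v \<le> 1 \<and> cl v \<noteq> 0)"
proof (induction "(weight w, length w)" arbitrary: w rule: wf_induct_rule[OF wf_lex_prod[OF wf_less_than wf_less_than]])
  case (1 w)
  have IH: ?case if "E v = E w" "cl v = cl w"
    "weight v < weight w \<or> weight v = weight w \<and> length v < length w" for v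
  proof -
    have "((weight v, length v), (weight w, length w)) \<in> less_than <*lex*> less_than"
      using that(3) by auto
    from 1[OF this] obtain v' where "E v' = E v" "cl v' = cl v" "weight v' \<le> weight v"
      "v' = [] \<or> (\<forall>i. weight (st v' i) < weight v') \<or> weight v' \<le> 1 \<and> cl v' \<noteq> 0"
      by blast
    then show ?thesis using that by (intro exI[of _ v']) auto
  qed
  have alt: "weight (st (alt xs) True) \<le> length xs div 2" "weight (st (alt xs) False) \<le> (length xs + 1) div 2"
    if "GA \<notin> set xs" for xs
  proof -
    have "weight (st (alt xs) True) = length xs div 2 \<and> weight (st (alt xs) False) = (length xs + 1) div 2"
      using that
    proof (induction xs)
      case (Cons x xs)
      then show ?case by (cases x) auto
    qed simp
    then show "weight (st (alt xs) True) \<le> length xs div 2" "weight (st (alt xs) False) \<le> (length xs + 1) div 2"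
      by auto
  qed
  have self: ?case if "\<And>i. weight (st w i) < weight w" using that by blast
  have small: ?case if "weight w \<le> 1" "cl w \<noteq> 0" using that by blast
  show ?case
  proof (cases w rule: word_cases)
    case (1 p q)
    show ?thesis
      by (rule IH[of "p @ q"]) (simp_all add: 1 gclass_cancel del: gclass.simps)
  next
    case (2 p x y q)
    obtain m where m: "E m = E [x, y]" "cl m = cl [x, y]" "weight m \<le> 1"
      using 2(2,3) by (rule merge_letters)
    show ?thesis
      by (rule IH[of "p @ m @ q"]) (use m 2 in \<open>simp_all add: add.assoc[symmetric]\<close>)
  next
    case (3 xs)
    show ?thesis
    proof (cases "length xs \<le> 1")
      case True
      then consider "xs = []" | x where "xs = [x]" by (cases xs) auto
      then show ?thesis
      proof cases
        case 1
        then have "w = []" using 3 by simp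
        then show ?thesis by blast
      next
        case (2 x)
        then show ?thesis using 3 by (intro small) (cases x; simp add: zero_cls_def)+
      qed
    next
      case False
      have "weight (st w i) < weight w" for i
        using alt[OF 3(2)] weight_alt[OF 3(2)] False unfolding 3(1) by (cases i) auto
      then show ?thesis by (rule self)
    qed
  next
    case (4 xs)
    show ?thesis
    proof (cases "length xs \<le> 1")
      case True
      then consider "xs = []" | x where "xs = [x]" by (cases xs) auto
      then show ?thesis
      proof cases
        case 1
        then show ?thesis using 4 by (intro small) (simp_all add: zero_cls_def)
      next
        case (2 x)
        then show ?thesis using 4 by (intro small) (cases x; simp add: zero_cls_def)+
      qed
    next
      case False
      have "weight (st w i) < weight w" for i
        using alt[OF 4(2)] weight_alt[OF 4(2)] False unfolding 4(1) by (cases i) auto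
      then show ?thesis by (rule self)
    qed
  next
    case (5 x xs)
    show ?thesis
    proof (cases xs)
      case Nil
      then show ?thesis using 5 by (intro small) (cases x; simp add: zero_cls_def)+
    next
      case (Cons y ys)
      have "weight (st w i) < weight w" for i
        using alt[OF 5(3)] weight_alt[OF 5(3)] 5(2) Cons unfolding 5(1)
        by (cases x; cases i) auto
      then show ?thesis by (rule self)
    qed
  next
    case (6 x xs)
    show ?thesis
    proof (cases xs)
      case Nil
      then show ?thesis using 6 by (intro small) (cases x; simp add: zero_cls_def)+
    next
      case (Cons y ys)
      have e: "st w i = st (x # alt xs) i" "weight w = weight (x # alt xs)" for i
        using st_append[of "x # alt xs" "[GA]" i] by (simp_all add: 6(1))
      have "weight (st w i) < weight w" for i
        using alt[OF 6(3)] weight_alt[OF 6(3)] 6(2) Cons unfolding e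
        by (cases x; cases i) auto
      then show ?thesis by (rule self)
    qed
  qed
qed

section \<open>Induction on the weight for elements of M\<close>

context
  fixes n :: nat
  assumes IH: "\<And>w. cl w = 0 \<Longrightarrow> weight w < n \<Longrightarrow> Sol ta_1_1_d (E w)"
begin

lemma states_less:
  assumes "cl w = 0" "weight w < n" "cl (st w False) = c" "cl (st w True) = c" "c \<in> {0, \<beta>, \<gamma>, \<delta>}"
  shows "Sol ta_1_1_d (E (rev [] @ st w True @ [] @ st w False))"
  using IH[of "st w True @ st w False"] cl_product[OF assms(3-5)] weight_st[of w] assms(2) by simp

lemma Sol_small:
  assumes u: "cl u = 0" "weight u < n"
  shows "mixed u \<or> cl (st u False) \<in> {0, \<beta>} \<Longrightarrow> Sol ta_1_1_c (E u)"
    and "mixed u \<or> cl (st u False) \<in> {\<gamma>, \<delta>} \<Longrightarrow> Sol ta_1_c_aca (E u)"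
    and "\<not> mixed u \<Longrightarrow> cl (st u False) \<in> {0, \<beta>} \<Longrightarrow> Sol t1_c_1_aca (E u)"
    and "\<not> mixed u \<Longrightarrow> cl (st u False) \<in> {\<gamma>, \<delta>} \<Longrightarrow> Sol ta_1_1_acac (E u)"
proof -
  let ?c = "cl (st u False)"
  have eq: "cl (st u True) = ?c" "?c \<in> {0, \<beta>, \<gamma>, \<delta>}" if "\<not> mixed u"
    using classes_0[OF u(1)] that by auto
  have S: "Sol ta_1_1_d (E (rev [] @ st u True @ [] @ st u False))" if "\<not> mixed u"
    by (rule states_less[OF u refl eq[OF that]])
  show "Sol ta_1_1_c (E u)" if c: "mixed u \<or> ?c \<in> {0, \<beta>}"
  proof (cases "mixed u")
    case False
    then have "kof ?c = 0" using c by (auto simp: zero_kls_def zero_cls_def)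
    then show ?thesis
      using merges_ta_1_1_c
      by (intro Sol_product[OF u(1) refl eq(1)[OF False] S[OF False]]) (simp only: kl_letters; blast)
  qed (rule Sol_mixed)
  show "Sol ta_1_c_aca (E u)" if c: "mixed u \<or> ?c \<in> {\<gamma>, \<delta>}"
  proof (cases "mixed u")
    case False
    then have "kof ?c = kacac" using c by auto
    then show ?thesis
      using merges_ta_1_c_aca
      by (intro Sol_product[OF u(1) refl eq(1)[OF False] S[OF False]]) (simp only: kl_letters; blast)
  qed (rule Sol_mixed)
  show "Sol t1_c_1_aca (E u)" if c: "\<not> mixed u" "?c \<in> {0, \<beta>}"
  proof (cases "?c = 0")
    case True
    then have "Sol ta_1_1_d (E (st u False))" "Sol ta_1_1_d (E (st u True))"
      using IH[of "st u False"] IH[of "st u True"] eq(1)[OF c(1)] weight_st[of u] u(2) by simp_all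
    then show ?thesis by (rule Sol_split[OF splits_t1_c_1_aca(1) states_0(1)[OF u(1)]])
  next
    case False
    then have "?c = \<beta>" "cl (st u True) = \<beta>" using c eq(1)[OF c(1)] by auto
    then have "solvable (st u False)" "solvable (st u True)" by (simp_all only: solvable_\<beta>)
    then show ?thesis unfolding solvable_def
      by (intro Sol_split[OF splits_t1_c_1_aca(2) states_0(1)[OF u(1)]]) blast+
  qed
  show "Sol ta_1_1_acac (E u)" if c: "\<not> mixed u" "?c \<in> {\<gamma>, \<delta>}"
    by (rule Sol_choice(2)[OF u(1) refl eq(1)[OF c(1)] c(2)])
qed

text \<open>The two states need systems that match. A mixed state offers both (a,1,1,c) and
  (a,1,c,aca) and adapts to the other state; unmixed states of different kinds are covered by the
  last two rows of the table.\<close>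

lemma Sol_1_1_1_b_states:
  assumes w: "cl w = 0" "cl (st w False) = 0" "cl (st w True) = 0"
    "weight (st w False) < n" "weight (st w True) < n"
  shows "Sol t1_1_1_b (E w)"
proof -
  let ?u = "st w False" and ?v = "st w True"
  let ?c = "cl (st ?u False)" and ?d = "cl (st ?v False)"
  note split = Sol_split[OF _ states_0(1)[OF w(1)]]
  note U = Sol_small[OF w(2,4)] and V = Sol_small[OF w(3,5)]
  have u: "mixed ?u \<or> ?c \<in> {0, \<beta>} \<or> ?c \<in> {\<gamma>, \<delta>}" using classes_0[OF w(2)] by auto
  have v: "mixed ?v \<or> ?d \<in> {0, \<beta>} \<or> ?d \<in> {\<gamma>, \<delta>}" using classes_0[OF w(3)] by auto
  consider "mixed ?u \<or> ?c \<in> {0, \<beta>}" "mixed ?v \<or> ?d \<in> {0, \<beta>}"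
    | "mixed ?u \<or> ?c \<in> {\<gamma>, \<delta>}" "mixed ?v \<or> ?d \<in> {\<gamma>, \<delta>}"
    | "\<not> mixed ?u" "\<not> mixed ?v" "?c \<in> {0, \<beta>}" "?d \<in> {\<gamma>, \<delta>}"
    | "\<not> mixed ?u" "\<not> mixed ?v" "?c \<in> {\<gamma>, \<delta>}" "?d \<in> {0, \<beta>}"
    using u v by blast
  then show ?thesis
  proof cases
    case 1 show ?thesis by (rule split[OF splits_t1_1_1_b(1) U(1)[OF 1(1)] V(1)[OF 1(2)]])
  next
    case 2 show ?thesis by (rule split[OF splits_t1_1_1_b(2) U(2)[OF 2(1)] V(2)[OF 2(2)]])
  next
    case 3 show ?thesis by (rule split[OF splits_t1_1_1_b(3) U(3)[OF 3(1,3)] V(4)[OF 3(2,4)]])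
  next
    case 4 show ?thesis by (rule split[OF splits_t1_1_1_b(4) U(4)[OF 4(1,3)] V(3)[OF 4(2,4)]])
  qed
qed

text \<open>The bound need not be strict: the hypothesis on lighter words is used only when both
  states lie in M, and then it is applied after passing to the states of an alternating
  word.\<close>

lemma Sol_rotations_le:
  assumes "cl w = 0" "weight w \<le> n"
  shows "Sol tac_1_1_b (E w) \<or> Sol t1_b_1_acac (E w) \<or> Sol t1_1_1_b (E w)"
proof -
  obtain v where v: "E v = E w" "cl v = 0" "weight v \<le> n"
    "v = [] \<or> (\<forall>i. weight (st v i) < weight v) \<or> weight v \<le> 1 \<and> cl v \<noteq> 0"
    using alternating_word[of w] assms by fastforce
  consider "v = []" | "mixed v" | c where "c \<in> {\<beta>, \<gamma>, \<delta>}" "cl (st v False) = c" "cl (st v True) = c"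
    | "cl (st v False) = 0" "cl (st v True) = 0" "\<forall>i. weight (st v i) < n"
    using classes_0[OF v(2)] v(2-4) by (metis insertE insertI1 insertI2 less_le_trans singletonD)
  then show ?thesis
  proof cases
    case 1
    have "Sol [0, 0, 0, kb] (comm 0 0 + comm 0 (E [GB]))"
      using Gam_word[of "[]"] Gam_word[of "[GB]"] by (intro Sol_4I) (simp_all only: kl_letters E_simps(1))
    then show ?thesis using 1 v(1) by (simp add: comm_def)
  next
    case 2 then show ?thesis using Sol_mixed(2) v(1) by metis
  next
    case (3 c) then show ?thesis using Sol_1_b_1_acac[OF v(2)] v(1) by metis
  next
    case 4 then show ?thesis using Sol_1_1_1_b_states[OF v(2)] v(1) by metis
  qed
qed

end

text \<open>The product of the states may weigh as much as w itself; this is why the preceding lemma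
  admits equality.\<close>

lemma Sol_1_1_d: "cl w = 0 \<Longrightarrow> Sol ta_1_1_d (E w)"
proof (induction "weight w" arbitrary: w rule: less_induct)
  case less
  let ?c = "cl (st w False)"
  show ?case
  proof (cases "mixed w")
    case True then show ?thesis by (rule Sol_mixed)
  next
    case False
    then have c: "cl (st w True) = ?c" "?c \<in> {0, \<beta>, \<gamma>, \<delta>}"
      using classes_0[OF less(2)] by auto
    show ?thesis
    proof (cases "?c \<in> {\<gamma>, \<delta>}")
      case True show ?thesis by (rule Sol_choice(1)[OF less(2) refl c(1) True])
    next
      case False
      then have k: "kof ?c = 0" using c(2) by (auto simp: zero_kls_def zero_cls_def)
      have "Sol tac_1_1_b (E (st w True @ st w False)) \<or> Sol t1_b_1_acac (E (st w True @ st w False)) \<or>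
        Sol t1_1_1_b (E (st w True @ st w False))"
        using less(1) weight_st[of w] cl_product[OF refl c]
        by (intro Sol_rotations_le[where n = "weight w"]) auto
      then obtain t where t: "Sol t (E (rev [] @ st w True @ [] @ st w False))"
        "t = tac_1_1_b \<or> t = t1_b_1_acac \<or> t = t1_1_1_b" by auto
      show ?thesis
        using t(2) k merges_ta_1_1_d
        by (intro Sol_product[OF less(2) refl c(1) t(1)]) (elim disjE; simp only: kl_letters; blast)
    qed
  qed
qed

text \<open>Unlike a, all entries of these four systems lie in R, as the states of conjugates of a
  require.\<close>

lemma Sol_K:
  assumes "kl w = 0"
  shows "Sol tac_b_1_1 (E w) \<or> Sol tac_1_1_b (E w) \<or> Sol t1_b_1_acac (E w) \<or> Sol t1_1_1_b (E w)"
proof -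
  have "cl w = \<beta> \<or> cl w = 0"
    using assms unfolding kl_def by (cases "cl w") (auto simp: zero_kls_def zero_cls_def)
  then show ?thesis
    using Sol_ac_b_1_1 Sol_rotations_le[OF Sol_1_1_d _ order_refl] by blast
qed

section \<open>Products of conjugates\<close>

lemma carrier_grigorchuk: "carrier grigorchuk = {Rep_tperm (E w) | w. True}"
proof -
  have "generate Aut_T2 {gen_a, gen_b, gen_c, gen_d} = {Rep_tperm (E w) | w. True}"
  proof (intro equalityI subsetI)
    fix g assume "g \<in> generate Aut_T2 {gen_a, gen_b, gen_c, gen_d}"
    then show "g \<in> {Rep_tperm (E w) | w. True}"
    proof induction
      case one
      have "\<one>\<^bsub>Aut_T2\<^esub> = Rep_tperm (E [])" by (simp add: Aut_T2_def Rep_zero)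
      then show ?case by blast
    next
      case (incl h)
      then have "\<exists>x. h = Rep_tperm (E [x])"
        using Rep_gperm[of GA] Rep_gperm[of GB] Rep_gperm[of GC] Rep_gperm[of GD]
        by (auto simp: eq_commute)
      then show ?case by blast
    next
      case (inv h)
      then obtain x where x: "h = Rep_tperm (gperm x)"
        using Rep_gperm[of GA] Rep_gperm[of GB] Rep_gperm[of GC] Rep_gperm[of GD]
        by (auto simp: eq_commute)
      have "h \<in> carrier Aut_T2" using inv gens_in_Aut_T2 by blast
      moreover have "h \<otimes>\<^bsub>Aut_T2\<^esub> h = \<one>\<^bsub>Aut_T2\<^esub>"
        using gperm_cancel(2)[of x] unfolding x
        by (simp add: Aut_T2_def flip: Rep_plus Rep_zero)
      ultimately have "inv\<^bsub>Aut_T2\<^esub> h = h" by (intro group.inv_equality[OF group_Aut_T2])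
      then show ?case by (intro CollectI exI[of _ "[x]"]) (simp add: x)
    next
      case (eng h1 h2)
      then obtain u v where "h1 = Rep_tperm (E u)" "h2 = Rep_tperm (E v)" by blast
      then have "h1 \<otimes>\<^bsub>Aut_T2\<^esub> h2 = Rep_tperm (E (u @ v))" by (simp add: Aut_T2_def Rep_plus)
      then show ?case by blast
    qed
  next
    fix g assume "g \<in> {Rep_tperm (E w) | w. True}"
    then obtain w where "g = Rep_tperm (E w)" by blast
    moreover have "Rep_tperm (E w) \<in> generate Aut_T2 {gen_a, gen_b, gen_c, gen_d}"
    proof (induction w)
      case Nil
      have one: "Rep_tperm (E []) = \<one>\<^bsub>Aut_T2\<^esub>" by (simp add: Aut_T2_def Rep_zero)
      show ?case unfolding one by (rule generate.one)
    next
      case (Cons x w)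
      have g: "Rep_tperm (gperm x) \<in> generate Aut_T2 {gen_a, gen_b, gen_c, gen_d}"
        unfolding Rep_gperm by (cases x) (auto intro: generate.incl)
      have eng: "Rep_tperm (E (x # w)) = Rep_tperm (gperm x) \<otimes>\<^bsub>Aut_T2\<^esub> Rep_tperm (E w)"
        by (simp add: Aut_T2_def Rep_plus)
      show ?case unfolding eng by (rule generate.eng[OF g Cons])
    qed
    ultimately show "g \<in> generate Aut_T2 {gen_a, gen_b, gen_c, gen_d}" by simp
  qed
  then show ?thesis by (simp add: grigorchuk_def)
qed

lemma Rep_E_carrier [simp]: "Rep_tperm (E w) \<in> carrier grigorchuk"
  by (auto simp: carrier_grigorchuk)

lemma mult_grigorchuk: "Rep_tperm x \<otimes>\<^bsub>grigorchuk\<^esub> Rep_tperm y = Rep_tperm (x + y)"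
  by (simp add: grigorchuk_def Aut_T2_def Rep_plus)

lemma one_grigorchuk: "\<one>\<^bsub>grigorchuk\<^esub> = Rep_tperm 0"
  by (simp add: grigorchuk_def Aut_T2_def Rep_zero)

lemma inv_grigorchuk: "inv\<^bsub>grigorchuk\<^esub> Rep_tperm (E w) = Rep_tperm (- E w)"
proof (rule group.inv_equality[OF group_grigorchuk])
  show "Rep_tperm (- E w) \<otimes>\<^bsub>grigorchuk\<^esub> Rep_tperm (E w) = \<one>\<^bsub>grigorchuk\<^esub>"
    by (simp add: mult_grigorchuk one_grigorchuk)
  show "Rep_tperm (- E w) \<in> carrier grigorchuk" using Rep_E_carrier[of "rev w"] by simp
qed simp

definition conj_gens :: "gen set \<Rightarrow> tperm set" where
  "conj_gens S = {- E w + gperm x + E w | w x. x \<in> S}"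

lemma conjugates_grigorchuk:
  "conjugates grigorchuk (gfun ` S) = Rep_tperm ` conj_gens S"
proof -
  have c: "inv\<^bsub>grigorchuk\<^esub> Rep_tperm (E w) \<otimes>\<^bsub>grigorchuk\<^esub> gfun x \<otimes>\<^bsub>grigorchuk\<^esub> Rep_tperm (E w)
    = Rep_tperm (- E w + gperm x + E w)" for w x
    by (simp only: inv_grigorchuk Rep_gperm[symmetric] mult_grigorchuk)
  show ?thesis
  proof (intro equalityI subsetI)
    fix g assume "g \<in> conjugates grigorchuk (gfun ` S)"
    then obtain h s where g: "g = inv\<^bsub>grigorchuk\<^esub> h \<otimes>\<^bsub>grigorchuk\<^esub> s \<otimes>\<^bsub>grigorchuk\<^esub> h"
      and "h \<in> carrier grigorchuk" "s \<in> gfun ` S"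
      unfolding conjugates_def by (elim CollectE exE conjE)
    then obtain w x where "h = Rep_tperm (E w)" "s = gfun x" "x \<in> S"
      unfolding carrier_grigorchuk by (elim CollectE exE conjE imageE)
    then show "g \<in> Rep_tperm ` conj_gens S"
      unfolding g conj_gens_def by (simp only: c) (intro imageI CollectI exI[of _ w] exI[of _ x] conjI refl)
  next
    fix g assume "g \<in> Rep_tperm ` conj_gens S"
    then obtain w x where x: "x \<in> S" "g = Rep_tperm (- E w + gperm x + E w)"
      unfolding conj_gens_def by (elim imageE CollectE exE conjE) simp
    show "g \<in> conjugates grigorchuk (gfun ` S)"
      unfolding conjugates_def x(2) c[symmetric]
      by (intro CollectI exI[of _ "Rep_tperm (E w)"] exI[of _ "gfun x"] conjI refl Rep_E_carrier imageI x(1))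
  qed
qed

lemma foldr_grigorchuk:
  "foldr (\<otimes>\<^bsub>grigorchuk\<^esub>) (map Rep_tperm xs) \<one>\<^bsub>grigorchuk\<^esub> = Rep_tperm (sum_list xs)"
  by (induction xs) (simp_all add: one_grigorchuk mult_grigorchuk)

lemma products_grigorchuk:
  "Rep_tperm x \<in> products grigorchuk n (conjugates grigorchuk (gfun ` S)) \<longleftrightarrow>
   (\<exists>xs. length xs = n \<and> set xs \<subseteq> conj_gens S \<and> x = sum_list xs)"
proof
  assume "Rep_tperm x \<in> products grigorchuk n (conjugates grigorchuk (gfun ` S))"
  then obtain ys where ys: "length ys = n" "set ys \<subseteq> Rep_tperm ` conj_gens S"
    "Rep_tperm x = foldr (\<otimes>\<^bsub>grigorchuk\<^esub>) ys \<one>\<^bsub>grigorchuk\<^esub>"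
    unfolding products_def conjugates_grigorchuk by (elim CollectE exE conjE)
  have "ys \<in> lists (Rep_tperm ` conj_gens S)" using ys(2) by (simp add: lists_eq_set)
  then obtain xs where "set xs \<subseteq> conj_gens S" "ys = map Rep_tperm xs"
    unfolding lists_image by (elim imageE) (simp add: lists_eq_set)
  then show "\<exists>xs. length xs = n \<and> set xs \<subseteq> conj_gens S \<and> x = sum_list xs"
    using ys(1,3) by (auto simp: foldr_grigorchuk Rep_tperm_inject)
next
  assume "\<exists>xs. length xs = n \<and> set xs \<subseteq> conj_gens S \<and> x = sum_list xs"
  then obtain xs where "length xs = n" "set xs \<subseteq> conj_gens S" "x = sum_list xs" by blast
  then show "Rep_tperm x \<in> products grigorchuk n (conjugates grigorchuk (gfun ` S))"
    unfolding products_def conjugates_grigorchuk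
    by (intro CollectI exI[of _ "map Rep_tperm xs"]) (auto simp: foldr_grigorchuk)
qed

text \<open>The subgroup of index 2 of \<open>G\<close> that governs the states of the conjugates of \<open>a\<close>.\<close>

definition RR :: "tperm set" where "RR = {E w | w. ki (kl w) = kk (kl w)}"

lemma RR_word: "ki (kl w) = kk (kl w) \<Longrightarrow> E w \<in> RR"
  by (auto simp: RR_def)

lemma RR_Gam: "(x, k) \<in> Gam \<Longrightarrow> ki k = kk k \<Longrightarrow> x \<in> RR"
  by (auto simp: Gam_def RR_def)

lemma RR_uminus: "x \<in> RR \<Longrightarrow> - x \<in> RR"
proof -
  assume "x \<in> RR"
  then obtain w where w: "x = E w" "ki (kl w) = kk (kl w)" by (auto simp: RR_def)
  then have "ki (kl (rev w)) = kk (kl (rev w))" by (cases "kl w") auto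
  from RR_word[OF this] show "- x \<in> RR" by (simp add: w)
qed

lemma RR_add: "x \<in> RR \<Longrightarrow> y \<in> RR \<Longrightarrow> x + y \<in> RR"
proof -
  assume "x \<in> RR" "y \<in> RR"
  then obtain u v where w: "x = E u" "y = E v" "ki (kl u) = kk (kl u)" "ki (kl v) = kk (kl v)"
    by (auto simp: RR_def)
  then have "ki (kl (u @ v)) = kk (kl (u @ v))" by (cases "kl u"; cases "kl v") auto
  from RR_word[OF this] show "x + y \<in> RR" by (simp add: w)
qed

lemma RR_diff: "x \<in> RR \<Longrightarrow> y \<in> RR \<Longrightarrow> x - y \<in> RR"
  using RR_add[OF _ RR_uminus, of x y] by simp

lemma conj_a_wre: "x \<in> RR \<Longrightarrow> wre x (- x) True \<in> conj_gens {GA}"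
proof -
  assume "x \<in> RR"
  then obtain u where u: "x = E u" "ki (kl u) = kk (kl u)" by (auto simp: RR_def)
  obtain i j k n where k: "kl u = Kls i j k n" by (cases "kl u")
  \<comment> \<open>Conjugating a by <<v, v x>> gives the states x and its inverse, so v only has to
    make the classes of v and v x a valid pair.\<close>
  define v where "v = (if i then (if n then [GD] else [GA]) else if n then [GA, GD] else [])"
  have "valid (kl v) (kl (v @ u))"
    using u(2) k by (cases i; cases n) (simp_all add: v_def zero_kls_def)
  then have "(wre (E v) (E (v @ u)) False, pr (kl v) (kl (v @ u))) \<in> Gam"
    using Gam_wre[OF Gam_word Gam_word, of v "v @ u" False] by simp
  then obtain w where w: "E w = wre (E v) (E (v @ u)) False" by (auto simp: Gam_def)
  have "- E w + gperm GA + E w = wre x (- x) True"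
    unfolding w gperm_wre(1) u(1)
    by (simp add: wre_uminus wre_add minus_add add.assoc add_minus_cancels diff_plus
        del: add_uminus_conv_diff)
  then show ?thesis unfolding conj_gens_def by (intro CollectI exI[of _ w] exI[of _ GA]) simp
qed

text \<open>Validity exchanges the components \<open>ki\<close> and \<open>kk\<close> between the
  two states, so they agree for a quotient of one state by the other.\<close>

lemma conj_a_cases:
  assumes "y \<in> conj_gens {GA}"
  obtains x where "x \<in> RR" "y = wre x (- x) True"
proof -
  obtain w where y: "y = - E w + gperm GA + E w" using assms by (auto simp: conj_gens_def)
  let ?x = "- E (st w (active w)) + E (st w (\<not> active w))"
  have "ki (kl (rev (st w i) @ st w (\<not> i))) = kk (kl (rev (st w i) @ st w (\<not> i)))" for i
    using class_states[of w] by (cases i; cases "kl (st w False)"; cases "kl (st w True)") auto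
  then have "?x \<in> RR"
    using RR_word[of "rev (st w (active w)) @ st w (\<not> active w)"] by simp
  moreover have "y = wre ?x (- ?x) True"
    unfolding y E_st[of w] gperm_wre(1)
    by (cases "active w") (simp_all add: wre_uminus wre_add minus_add)
  ultimately show ?thesis using that by blast
qed

lemma six_conjugates:
  fixes w :: word
  assumes w: "\<not> ci (cl w)" "\<not> cj (cl w)" "\<not> ck (cl w)"
  shows "\<exists>xs. length xs = 6 \<and> set xs \<subseteq> conj_gens {GA} \<and> E w = sum_list xs"
proof -
  define h1 where "h1 = st w False"
  define h2 where "h2 = st w True"
  have a: "\<not> active w" using w by (simp add: active_cl)
  have cs: "kl (rev h1 @ rev h2) = 0 \<and> ki (kl h1) = kk (kl h1) \<and> ki (kl h2) = kk (kl h2)"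
    using class_states[of w] a w unfolding h1_def h2_def
    by (cases "kl (st w False)"; cases "kl (st w True)") (auto simp: zero_kls_def)
  obtain k1 k2 k3 k4 where "Sol [k1, k2, k3, k4] (E (rev h1 @ rev h2))"
    and k: "ki k1 = kk k1" "ki k2 = kk k2" "ki k3 = kk k3" "ki k4 = kk k4"
    using Sol_K[OF conjunct1[OF cs]] by (elim disjE) (auto simp: zero_kls_def)
  then obtain p q r s where "(p, k1) \<in> Gam" "(q, k2) \<in> Gam" "(r, k3) \<in> Gam" "(s, k4) \<in> Gam"
    and "comm p q + comm r s = E (rev h1 @ rev h2)"
    by (elim Sol_4E)
  then have G: "p \<in> RR" "q \<in> RR" "r \<in> RR" "s \<in> RR"
    and eq: "comm p q + comm r s = - E h1 - E h2"
    using RR_Gam k by simp_all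
  have h: "E h1 \<in> RR" using cs by (intro RR_word) blast
  \<comment> \<open>Two conjugates of a multiply to <<t', t^-1 t'^-1 t>> with t, t' free in R. The
    three pairs have first states s1, s2, r with s1 s2 r = h1. Taking s2, u2 to be p, q conjugated
    past r turns s1 y x into h1 [p,q][r,s].\<close>
  define s2 where "s2 = r + p - r"
  define s1 where "s1 = E h1 - r - s2"
  define u2 where "u2 = r + q - r"
  define x where "x = - s + r + s"
  define y where "y = - u2 + s2 + u2"
  have h2: "E h2 = - x - y - s1"
  proof -
    have "s1 + y + x = E h1 + (comm p q + comm r s)"
      unfolding s1_def s2_def u2_def x_def y_def comm_def
      by (simp add: minus_add add.assoc add_minus_cancels diff_plus del: add_uminus_conv_diff)
    also have "\<dots> = - E h2" unfolding eq by (simp add: diff_plus add_minus_cancels del: add_uminus_conv_diff)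
    finally have "E h2 = - (s1 + y + x)" by simp
    then show ?thesis by (simp add: minus_add diff_plus add.assoc del: add_uminus_conv_diff)
  qed
  have pair: "wre t (- t) True + wre (- t' + t) (- (- t' + t)) True = wre t' (- t - t' + t) False" for t t'
    by (simp add: wre_add minus_add diff_plus add.assoc add_minus_cancels del: add_uminus_conv_diff)
  \<comment> \<open>The conjugators v1, v2 and s make the second states of the three pairs telescope
    to x^-1 y^-1 s1^-1.\<close>
  define v1 where "v1 = y + x"
  define v2 where "v2 = u2 + x"
  have m: "x \<in> RR" "y \<in> RR" "s1 \<in> RR" "s2 \<in> RR" "v1 \<in> RR" "v2 \<in> RR"
    unfolding x_def y_def s1_def s2_def u2_def v1_def v2_def
    by (intro RR_add RR_diff RR_uminus G h)+
  let ?c = "\<lambda>t. wre t (- t) True"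
  let ?xs = "[?c v1, ?c (- s1 + v1), ?c v2, ?c (- s2 + v2), ?c s, ?c (- r + s)]"
  have "set ?xs \<subseteq> conj_gens {GA}"
    using m G by (auto intro!: conj_a_wre RR_add RR_uminus)
  moreover have "sum_list ?xs = E w"
  proof -
    have "sum_list ?xs = wre s1 (- v1 - s1 + v1) False + (wre s2 (- v2 - s2 + v2) False + wre r (- s - r + s) False)"
      unfolding pair[symmetric] by (simp add: add.assoc)
    also have "\<dots> = wre (E h1) (E h2) False"
      unfolding h2 v1_def v2_def
      by (simp add: wre_add wre_inject s1_def x_def y_def minus_add diff_plus add.assoc
          add_minus_cancels del: add_uminus_conv_diff)
    also have "\<dots> = E w" using E_st[of w] a by (simp add: h1_def h2_def)
    finally show ?thesis .
  qed
  ultimately show ?thesis by (intro exI[of _ ?xs]) simp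
qed

section \<open>The derived subgroup and the bound for all of G\<close>

lemma commutator_grigorchuk:
  "Rep_tperm (E u) \<otimes>\<^bsub>grigorchuk\<^esub> Rep_tperm (E v) \<otimes>\<^bsub>grigorchuk\<^esub>
    inv\<^bsub>grigorchuk\<^esub> Rep_tperm (E u) \<otimes>\<^bsub>grigorchuk\<^esub> inv\<^bsub>grigorchuk\<^esub> Rep_tperm (E v) =
   Rep_tperm (E (u @ v @ rev u @ rev v))"
  unfolding inv_grigorchuk mult_grigorchuk
  by (simp add: diff_plus add.assoc del: add_uminus_conv_diff)

lemma derived_word:
  assumes "g \<in> derived grigorchuk (carrier grigorchuk)"
  shows "\<exists>w. g = Rep_tperm (E w) \<and> \<not> ci (cl w) \<and> \<not> cj (cl w) \<and> \<not> ck (cl w)"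
  using assms unfolding derived_def
proof induction
  case one
  show ?case by (rule exI[of _ "[]"]) (simp add: one_grigorchuk zero_cls_def)
next
  case (incl h)
  then obtain u v where "h = Rep_tperm (E (u @ v @ rev u @ rev v))"
    unfolding carrier_grigorchuk commutator_grigorchuk[symmetric] by blast
  moreover have "\<not> ci (cl (u @ v @ rev u @ rev v)) \<and> \<not> cj (cl (u @ v @ rev u @ rev v)) \<and>
    \<not> ck (cl (u @ v @ rev u @ rev v))"
    by (cases "cl u"; cases "cl v") auto
  ultimately show ?case by blast
next
  case (inv h)
  then obtain u v where h: "h = Rep_tperm (E (u @ v @ rev u @ rev v))"
    unfolding carrier_grigorchuk commutator_grigorchuk[symmetric] by blast
  have "inv\<^bsub>grigorchuk\<^esub> h = Rep_tperm (E (rev (u @ v @ rev u @ rev v)))"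
    unfolding h inv_grigorchuk E_rev ..
  moreover have "\<not> ci (cl (rev (u @ v @ rev u @ rev v))) \<and> \<not> cj (cl (rev (u @ v @ rev u @ rev v))) \<and>
    \<not> ck (cl (rev (u @ v @ rev u @ rev v)))"
    by (cases "cl u"; cases "cl v") auto
  ultimately show ?case by blast
next
  case (eng g h)
  then obtain u v where w: "g = Rep_tperm (E u)" "\<not> ci (cl u)" "\<not> cj (cl u)" "\<not> ck (cl u)"
    "h = Rep_tperm (E v)" "\<not> ci (cl v)" "\<not> cj (cl v)" "\<not> ck (cl v)" by blast
  then have "g \<otimes>\<^bsub>grigorchuk\<^esub> h = Rep_tperm (E (u @ v))" by (simp add: mult_grigorchuk)
  moreover have "\<not> ci (cl (u @ v)) \<and> \<not> cj (cl (u @ v)) \<and> \<not> ck (cl (u @ v))"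
    using w by (cases "cl u"; cases "cl v") auto
  ultimately show ?case by blast
qed

lemma eight_conjugates:
  "\<exists>n\<le>8. \<exists>xs. length xs = n \<and> set xs \<subseteq> conj_gens UNIV \<and> E w = sum_list xs"
proof -
  obtain i j k m n where c: "cl w = Cls i j k m n" by (cases "cl w")
  define v where "v = (if i then [GA] else []) @
    (if j \<and> k then [GC] else if j then [GB] else if k then [GD] else [])"
  have v: "length v \<le> 2" by (simp add: v_def)
  have "\<not> ci (cl (w @ rev v)) \<and> \<not> cj (cl (w @ rev v)) \<and> \<not> ck (cl (w @ rev v))"
    using c by (cases i; cases j; cases k) (simp_all add: v_def zero_cls_def)
  then obtain xs where xs: "length xs = 6" "set xs \<subseteq> conj_gens {GA}" "E (w @ rev v) = sum_list xs"
    using six_conjugates[of "w @ rev v"] by blast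
  have "conj_gens {GA} \<subseteq> conj_gens UNIV" by (auto simp: conj_gens_def)
  moreover have "gperm x \<in> conj_gens UNIV" for x
    unfolding conj_gens_def by (intro CollectI exI[of _ "[]"] exI[of _ x]) simp
  ultimately have "set (xs @ map gperm v) \<subseteq> conj_gens UNIV" using xs(2) by auto
  moreover have "E w = E (w @ rev v) + E v" by simp
  then have "E w = sum_list (xs @ map gperm v)" unfolding xs(3) by (simp add: E_def)
  ultimately show ?thesis
    using v xs(1) by (intro exI[of _ "length (xs @ map gperm v)"] conjI exI[of _ "xs @ map gperm v"]) auto
qed

section \<open>An element that is not a product of four conjugates\<close>

lemma class_by_states:
  assumes "cl w = Cls i j k m n" "kl (st w False) = Kls i0 j0 k0 n0" "kl (st w True) = Kls i1 j1 k1 n1"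
  shows "i = active w" "j = (i0 \<noteq> i1)" "k = ((i0 \<noteq> i1) \<noteq> (j0 \<noteq> j1))"
    "m = (i1 \<noteq> (active w \<and> (i0 \<noteq> i1)))" "n = ((j0 \<noteq> i1) \<noteq> (active w \<and> k))"
proof -
  have s: "i1 = k0" "k1 = i0"
    and c: "Cls i j k m n = prc (Kls i0 j0 k0 n0) (Kls i1 j1 k1 n1) + (if active w then gclass GA else 0)"
    using class_states[of w] unfolding assms by simp_all
  show "i = active w" "j = (i0 \<noteq> i1)" "k = ((i0 \<noteq> i1) \<noteq> (j0 \<noteq> j1))"
    "m = (i1 \<noteq> (active w \<and> (i0 \<noteq> i1)))" "n = ((j0 \<noteq> i1) \<noteq> (active w \<and> k))"
    using c unfolding s by (cases "active w"; auto simp: zero_cls_def)+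
qed

lemma states_E:
  assumes "E u = E v"
  shows "active u = active v" "E (st u i) = E (st v i)"
proof -
  have "wre (E (st u False)) (E (st u True)) (active u) = wre (E (st v False)) (E (st v True)) (active v)"
    unfolding E_st[symmetric] by (rule assms)
  then have eq: "E (st u False) = E (st v False)" "E (st u True) = E (st v True)" "active u = active v"
    unfolding wre_inject by blast+
  show "active u = active v" by (rule eq)
  show "E (st u i) = E (st v i)" using eq by (cases i) simp_all
qed

text \<open>The action on three levels determines the class: \<open>ci\<close> is the root action,
  \<open>cj\<close> follows from the components \<open>ki\<close> of the states, and the rest
  follows once \<open>kj\<close> of the states is known as well.\<close>

lemma cl_E:
  assumes "E u = E v"
  shows "cl u = cl v"
proof -
  note act = states_E
  have i: "ki (kl u) = ki (kl v)" if "E u = E v" for u v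
    using act(1)[OF that] unfolding active_cl kl_def by (cases "cl u"; cases "cl v") simp
  have j: "kj (kl u) = kj (kl v)" if "E u = E v" for u v
  proof -
    obtain i j k m n where u: "cl u = Cls i j k m n" by (cases "cl u")
    obtain i' j' k' m' n' where v: "cl v = Cls i' j' k' m' n'" by (cases "cl v")
    obtain i0 j0 k0 n0 where u0: "kl (st u False) = Kls i0 j0 k0 n0" by (cases "kl (st u False)")
    obtain i1 j1 k1 n1 where u1: "kl (st u True) = Kls i1 j1 k1 n1" by (cases "kl (st u True)")
    obtain i0' j0' k0' n0' where v0: "kl (st v False) = Kls i0' j0' k0' n0'" by (cases "kl (st v False)")
    obtain i1' j1' k1' n1' where v1: "kl (st v True) = Kls i1' j1' k1' n1'" by (cases "kl (st v True)")
    have "i0 = i0'" "i1 = i1'"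
      using i[OF act(2)[OF that, of False]] i[OF act(2)[OF that, of True]] by (simp_all add: u0 u1 v0 v1)
    then show ?thesis
      using class_by_states(2)[OF u u0 u1] class_by_states(2)[OF v v0 v1] by (simp add: kl_def u v)
  qed
  obtain i j k m n where u: "cl u = Cls i j k m n" by (cases "cl u")
  obtain i' j' k' m' n' where v: "cl v = Cls i' j' k' m' n'" by (cases "cl v")
  obtain i0 j0 k0 n0 where u0: "kl (st u False) = Kls i0 j0 k0 n0" by (cases "kl (st u False)")
  obtain i1 j1 k1 n1 where u1: "kl (st u True) = Kls i1 j1 k1 n1" by (cases "kl (st u True)")
  obtain i0' j0' k0' n0' where v0: "kl (st v False) = Kls i0' j0' k0' n0'" by (cases "kl (st v False)")
  obtain i1' j1' k1' n1' where v1: "kl (st v True) = Kls i1' j1' k1' n1'" by (cases "kl (st v True)")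
  have s: "i0 = i0'" "i1 = i1'"
    using i[OF act(2)[OF assms, of False]] i[OF act(2)[OF assms, of True]] by (simp_all add: u0 u1 v0 v1)
  have t: "j0 = j0'" "j1 = j1'"
    using j[OF act(2)[OF assms, of False]] j[OF act(2)[OF assms, of True]] by (simp_all add: u0 u1 v0 v1)
  show ?thesis
    using class_by_states[OF u u0 u1] class_by_states[OF v v0 v1] s t act(1)[OF assms]
    by (simp add: u v)
qed

lemma kl_E: "E u = E v \<Longrightarrow> kl u = kl v"
  by (simp add: kl_def cl_E[of u v])

section \<open>Commutators and their states in the finite quotients\<close>

definition wcomm :: "word \<Rightarrow> word \<Rightarrow> word" where "wcomm u v = rev u @ rev v @ u @ v"

lemma E_wcomm: "E (wcomm u v) = comm (E u) (E v)"
  by (simp add: wcomm_def comm_def diff_plus add.assoc del: add_uminus_conv_diff)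

text \<open>Since G/M is nilpotent of class 2, its commutators form two alternating forms on G/G',
  one pairing a with b and one pairing a with d.\<close>

lemma cl_wcomm:
  assumes "cl u = Cls i j k m n" "cl v = Cls i' j' k' m' n'"
  shows "cl (wcomm u v) =
    Cls False False False ((j \<and> i') \<noteq> (i \<and> j')) ((k \<and> i') \<noteq> (i \<and> k'))"
  unfolding wcomm_def cl_simps(3) cl_rev assms uminus_cls.simps plus_cls.simps cls.inject
  by (intro conjI; argo)

lemma st_wcomm_inactive:
  assumes "\<not> active u" "\<not> active v"
  shows "st (wcomm u v) i = wcomm (st u i) (st v i)"
  using st_rev[of u i] st_rev[of v i] assms by (simp add: wcomm_def)

lemma st_wcomm_active:
  assumes "active u" "\<not> active v"
  shows "st (wcomm u v) i = rev (st u (\<not> i)) @ rev (st v (\<not> i)) @ st u (\<not> i) @ st v i"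
  using st_rev[of u "\<not> i"] st_rev[of v "\<not> i"] assms by (simp add: wcomm_def)

lemma st_rev': "st (rev w) i = rev (st w (i \<noteq> active w))"
  using st_rev[of w "i \<noteq> active w"] by (cases "active w") simp_all

text \<open>Modulo \<open>K \<times> K\<close>, the commutator of two elements that generate, modulo \<open>G'\<close>, the subgroup
  spanned by \<open>a b\<close> and \<open>d\<close> is always \<open>(a d)\<^sup>2\<close>.\<close>

lemma commutator_ab_d:
  assumes u: "cl u = Cls i i k m n" and v: "cl v = Cls i' i' k' m' n'"
    and det: "(k \<and> i') \<noteq> (i \<and> k')"
  shows "kn (kl (st (wcomm u v) False)) = False"
proof -
  obtain i0 j0 k0 n0 where u0: "kl (st u False) = Kls i0 j0 k0 n0" by (cases "kl (st u False)")
  obtain i1 j1 k1 n1 where u1: "kl (st u True) = Kls i1 j1 k1 n1" by (cases "kl (st u True)")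
  obtain i0' j0' k0' n0' where v0: "kl (st v False) = Kls i0' j0' k0' n0'" by (cases "kl (st v False)")
  obtain i1' j1' k1' n1' where v1: "kl (st v True) = Kls i1' j1' k1' n1'" by (cases "kl (st v True)")
  note U = class_by_states[OF u u0 u1] and V = class_by_states[OF v v0 v1]
  have vu: "i1 = k0" "k1 = i0" "n1 = (n0 \<noteq> (i0 \<and> k0))" "i1' = k0'" "k1' = i0'" "n1' = (n0' \<noteq> (i0' \<and> k0'))"
    using class_states[of u] class_states[of v] u0 u1 v0 v1 by simp_all
  have "st (wcomm u v) False = rev (st u i) @ rev (st v (i \<noteq> i')) @ st u (i \<noteq> i') @ st v i'"
    using U(1) V(1) by (cases "active u"; cases "active v") (simp_all add: wcomm_def st_rev')
  then have "kl (st (wcomm u v) False) =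
    - kl (st u i) + (- kl (st v (i \<noteq> i')) + (kl (st u (i \<noteq> i')) + kl (st v i')))"
    by (simp add: add.assoc diff_plus del: add_uminus_conv_diff)
  then show ?thesis
    using U(2,3) V(2,3) det unfolding vu
    by (cases i; cases i'; cases k; cases k') (auto simp: u0 u1 v0 v1 vu)
qed

lemma inactive_RR_states:
  assumes "\<not> active w" "ki (kl w) = kk (kl w)"
  shows "\<exists>i j k n. kl (st w False) = Kls i j k n \<and>
    kl (st w True) = Kls k (i \<noteq> (j \<noteq> k)) i (n \<noteq> (i \<and> k))"
proof -
  obtain i j k n where 0: "kl (st w False) = Kls i j k n" by (cases "kl (st w False)")
  obtain i' j' k' n' where 1: "kl (st w True) = Kls i' j' k' n'" by (cases "kl (st w True)")
  show ?thesis using class_states[of w] assms unfolding kl_def[of w] by (auto simp: 0 1)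
qed

text \<open>If both commutators of states have class \<open>\<delta>\<close>, the alternating forms
  force the states into the span of a b and d modulo G', with nonzero determinant; then the lemma on
  a b and d applies to the second states.\<close>

lemma not_commutator_inactive:
  assumes "\<not> active u" "\<not> active v" "ki (kl u) = kk (kl u)" "ki (kl v) = kk (kl v)"
    and "cl (st (wcomm u v) False) = \<delta>" "cl (st (wcomm u v) True) = \<delta>"
  shows "kn (kl (st (st (wcomm u v) True) False)) = False"
proof -
  obtain i j k n where u: "kl (st u False) = Kls i j k n"
    "kl (st u True) = Kls k (i \<noteq> (j \<noteq> k)) i (n \<noteq> (i \<and> k))"
    using inactive_RR_states[OF assms(1,3)] by blast
  obtain i' j' k' n' where v: "kl (st v False) = Kls i' j' k' n'"
    "kl (st v True) = Kls k' (i' \<noteq> (j' \<noteq> k')) i' (n' \<noteq> (i' \<and> k'))"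
    using inactive_RR_states[OF assms(2,4)] by blast
  obtain m0 where u0: "cl (st u False) = Cls i j k m0 n" using u(1) by (cases "cl (st u False)") (simp add: kl_def)
  obtain m1 where u1: "cl (st u True) = Cls k (i \<noteq> (j \<noteq> k)) i m1 (n \<noteq> (i \<and> k))"
    using u(2) by (cases "cl (st u True)") (simp add: kl_def)
  obtain m0' where v0: "cl (st v False) = Cls i' j' k' m0' n'" using v(1) by (cases "cl (st v False)") (simp add: kl_def)
  obtain m1' where v1: "cl (st v True) = Cls k' (i' \<noteq> (j' \<noteq> k')) i' m1' (n' \<noteq> (i' \<and> k'))"
    using v(2) by (cases "cl (st v True)") (simp add: kl_def)
  have "cl (wcomm (st u False) (st v False)) = \<delta>" "cl (wcomm (st u True) (st v True)) = \<delta>"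
    using assms(5,6) by (simp_all add: st_wcomm_inactive assms(1,2))
  then have eqs: "(j \<and> i') = (i \<and> j')" "(k \<and> i') \<noteq> (i \<and> k')"
    "((i \<noteq> (j \<noteq> k)) \<and> k') = (k \<and> (i' \<noteq> (j' \<noteq> k')))"
    unfolding cl_wcomm[OF u0 v0] cl_wcomm[OF u1 v1] cls.inject by argo+
  then have det: "(k \<and> i') \<noteq> (i \<and> k')" "j = i" "j' = i'" by argo+
  show ?thesis
    unfolding st_wcomm_inactive[OF assms(1,2)]
    by (rule commutator_ab_d[of _ k i m1 "n \<noteq> (i \<and> k)" _ k' i' m1' "n' \<noteq> (i' \<and> k')"])
      (use u1 v1 det in auto)
qed

text \<open>Both states of v agree modulo G'. The components \<open>cn\<close> force them to contain
  an odd number of letters a and the states of u to have equal components \<open>ci\<close>. Then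
  the components \<open>cm\<close> make the states of u agree in \<open>cj\<close>, whereas for an
  active u in R they must differ there.\<close>

lemma not_commutator_active:
  assumes "active u" "\<not> active v" "ki (kl u) = kk (kl u)" "ki (kl v) = kk (kl v)"
  shows "\<not> (cl (st (wcomm u v) False) = \<delta> \<and> cl (st (wcomm u v) True) = \<delta>)"
proof
  assume a: "cl (st (wcomm u v) False) = \<delta> \<and> cl (st (wcomm u v) True) = \<delta>"
  obtain i j k m n where u0: "cl (st u False) = Cls i j k m n" by (cases "cl (st u False)")
  obtain i' j' k' m' n' where u1: "cl (st u True) = Cls i' j' k' m' n'" by (cases "cl (st u True)")
  obtain p q r s t where v0: "cl (st v False) = Cls p q r s t" by (cases "cl (st v False)")
  obtain p' q' r' s' t' where v1: "cl (st v True) = Cls p' q' r' s' t'" by (cases "cl (st v True)")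
  have vu: "i' = k" "k' = i" "n' = (n \<noteq> (i \<and> k))" "p' = r" "r' = p" "t' = (t \<noteq> (p \<and> r))"
    using class_states[of u] class_states[of v] u0 u1 v0 v1 by (simp_all add: kl_def)
  have R: "j' = (\<not> (i \<noteq> (j \<noteq> k)))" "q' = (p \<noteq> (q \<noteq> r))"
    using class_states[of u] class_states[of v] assms u0 u1 v0 v1 vu by (auto simp: kl_def)
  have "cl (st (wcomm u v) x) =
    cl (wcomm (st u (\<not> x)) (st v (\<not> x))) + (- cl (st v (\<not> x)) + cl (st v x))" for x
    unfolding st_wcomm_active[OF assms(1,2)]
    unfolding wcomm_def cl_simps(3) cl_rev by (simp only: add.assoc add_minus_cancels)
  from this[of False] this[of True]
  have "\<delta> = cl (wcomm (st u True) (st v True)) + (- cl (st v True) + cl (st v False))"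
    "\<delta> = cl (wcomm (st u False) (st v False)) + (- cl (st v False) + cl (st v True))"
    using a by simp_all
  then have "p = p'" "r = r'" "((j' \<and> p') \<noteq> (i' \<and> q')) = (((s' \<noteq> (q' \<and> p')) \<noteq> s) \<noteq> (q' \<and> p))"
    "((k' \<and> p') \<noteq> (i' \<and> r')) \<noteq> (((t' \<noteq> (r' \<and> p')) \<noteq> t) \<noteq> (r' \<and> p))"
    "q = q'" "((j \<and> p) \<noteq> (i \<and> q)) = (((s \<noteq> (q \<and> p)) \<noteq> s') \<noteq> (q \<and> p'))"
    unfolding cl_wcomm[OF u0 v0] cl_wcomm[OF u1 v1] v0 v1 uminus_cls.simps plus_cls.simps cls.inject
    by argo+
  then show False using vu R by argo
qed

text \<open>This is \<open>\<langle>\<langle>1, k\<rangle>\<rangle>\<close> for \<open>k = [a,b] [a,b]\<^bsup>ca\<^esup> [aba, adad]\<close>, both of whose states are \<open>(a d)\<^sup>2\<close> modulo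
  \<open>M\<close>, but the second one is not \<open>(a d)\<^sup>2\<close> modulo \<open>K \<times> K\<close>.\<close>

definition wit :: word where
  "wit =
    (let u = [GA, GB, GA]; v = [GD]; g = [GA, GB, GA, GB]; u' = g @ u @ rev g; v' = g @ v @ rev g;
         x = [GA, GB, GA, GD, GA, GB, GA]; y = [GA, GB, GA, GC, GA, GB, GA, GC]
     in (u @ v @ rev u @ rev v) @ (u' @ v' @ rev u' @ rev v') @ (x @ y @ rev x @ rev y))"

lemma wit_states:
  "\<not> active wit" "E (st wit False) = 0" "\<not> active (st wit True)"
  "cl (st (st wit True) False) = \<delta>" "cl (st (st wit True) True) = \<delta>"
  "\<not> active (st (st wit True) True)" "kn (kl (st (st (st wit True) True) False))"
  by (simp_all add: wit_def Let_def zero_cls_def zero_kls_def add.assoc)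

lemma wit_derived: "Rep_tperm (E wit) \<in> derived grigorchuk (carrier grigorchuk)"
proof -
  have c: "Rep_tperm (E (u @ v @ rev u @ rev v)) \<in>
    generate grigorchuk (\<Union>h1\<in>carrier grigorchuk. \<Union>h2\<in>carrier grigorchuk.
      {h1 \<otimes>\<^bsub>grigorchuk\<^esub> h2 \<otimes>\<^bsub>grigorchuk\<^esub> inv\<^bsub>grigorchuk\<^esub> h1 \<otimes>\<^bsub>grigorchuk\<^esub> inv\<^bsub>grigorchuk\<^esub> h2})" for u v
    unfolding commutator_grigorchuk[symmetric]
    by (rule generate.incl) (intro UN_I[of "Rep_tperm (E u)"] UN_I[of "Rep_tperm (E v)"] Rep_E_carrier singletonI)
  have e: "Rep_tperm (E (u @ v)) = Rep_tperm (E u) \<otimes>\<^bsub>grigorchuk\<^esub> Rep_tperm (E v)" for u v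
    by (simp add: mult_grigorchuk)
  show ?thesis
    unfolding derived_def wit_def Let_def
    by (subst e, rule generate.eng[OF c], subst e, rule generate.eng[OF c c])
qed

lemma wit_not_commutator_inactive:
  assumes "\<not> active v" "ki (kl u) = kk (kl u)" "ki (kl v) = kk (kl v)"
  shows "E (st wit True) \<noteq> E (wcomm u v)"
proof
  assume eq: "E (st wit True) = E (wcomm u v)"
  note s = states_E(2)[OF eq]
  have c: "cl (st (wcomm u v) False) = \<delta>" "cl (st (wcomm u v) True) = \<delta>"
    using cl_E[OF s, of False] cl_E[OF s, of True] wit_states(4,5) by simp_all
  have u: "\<not> active u" using not_commutator_active[of u v] assms c by blast
  have "kn (kl (st (st (wcomm u v) True) False)) = False"
    by (rule not_commutator_inactive[OF u assms(1-3) c])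
  then show False
    using kl_E[OF states_E(2)[OF s], of True False] wit_states(7) by simp
qed

text \<open>The moves (x,y) to (y x, y) and (x, x y) preserve the commutator and stay in R; they
  reduce to the case where the second element fixes the first level.\<close>

lemma wit_not_commutator:
  assumes "ki (kl u) = kk (kl u)" "ki (kl v) = kk (kl v)"
  shows "E (st wit True) \<noteq> comm (E u) (E v)"
proof -
  have R: "ki (kl (p @ q)) = kk (kl (p @ q))" if "ki (kl p) = kk (kl p)" "ki (kl q) = kk (kl q)" for p q
    using that by (cases "kl p"; cases "kl q") auto
  have 1: "comm (y + x) y = comm x y" "comm x (x + y) = comm x y" for x y :: tperm
    by (simp_all add: comm_def minus_add diff_plus add.assoc add_minus_cancels del: add_uminus_conv_diff)
  have act: "E (st wit True) \<noteq> comm (E p) (E q)"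
    if "active p" "ki (kl p) = kk (kl p)" "ki (kl q) = kk (kl q)" for p q
  proof (cases "active q")
    case True
    have "E (st wit True) \<noteq> E (wcomm p (p @ q))"
      by (rule wit_not_commutator_inactive) (use that True R in auto)
    then show ?thesis by (simp add: E_wcomm 1)
  next
    case False
    then show ?thesis using wit_not_commutator_inactive[OF False that(2,3)] by (simp add: E_wcomm)
  qed
  show ?thesis
  proof (cases "active v")
    case False
    then show ?thesis using wit_not_commutator_inactive[OF False assms] by (simp add: E_wcomm)
  next
    case v: True
    show ?thesis
    proof (cases "active u")
      case True then show ?thesis using act assms by blast
    next
      case False
      have "E (st wit True) \<noteq> comm (E (v @ u)) (E v)"
        by (rule act) (use v False assms R in auto)
      then show ?thesis by (simp add: 1)
    qed
  qed
qed

lemma four_conjugates: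
  assumes "set xs \<subseteq> conj_gens {GA}" "length xs = 4"
  shows "E wit \<noteq> sum_list xs"
proof
  assume eq: "E wit = sum_list xs"
  obtain c1 c2 c3 c4 where xs: "xs = [c1, c2, c3, c4]"
    using assms(2) by (auto simp: numeral_eq_Suc length_Suc_conv)
  obtain x1 where x1: "x1 \<in> RR" "c1 = wre x1 (- x1) True" using assms(1) xs by (auto elim: conj_a_cases)
  obtain y1 where y1: "y1 \<in> RR" "c2 = wre y1 (- y1) True" using assms(1) xs by (auto elim: conj_a_cases)
  obtain x2 where x2: "x2 \<in> RR" "c3 = wre x2 (- x2) True" using assms(1) xs by (auto elim: conj_a_cases)
  obtain y2 where y2: "y2 \<in> RR" "c4 = wre y2 (- y2) True" using assms(1) xs by (auto elim: conj_a_cases)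
  have "wre 0 (E (st wit True)) False = E wit" using E_st[of wit] wit_states(1,2) by simp
  also have "\<dots> = wre (x1 - y1 + (x2 - y2)) (- x1 + y1 + (- x2 + y2)) False"
    unfolding eq xs x1 y1 x2 y2
    by (simp add: wre_add add.assoc diff_plus del: add_uminus_conv_diff)
  finally have 1: "x1 - y1 + (x2 - y2) = 0" and 2: "E (st wit True) = - x1 + y1 + (- x2 + y2)"
    unfolding wre_inject by simp_all
  \<comment> \<open>Triviality of the first state means x1 y1^-1 = y2 x2^-1. In terms of this common
    value s the second state is x1^-1 s^-1 x1 x2^-1 s x2, which is the commutator of x2^-1 x1 and
    x2^-1 s x2.\<close>
  define s where "s = x1 - y1"
  have y1': "y1 = - s + x1" unfolding s_def by (simp add: minus_add diff_plus add.assoc del: add_uminus_conv_diff)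
  have "- s = x2 - y2" using 1 unfolding s_def by (rule minus_unique)
  then have "s = y2 - x2" by (metis minus_diff_eq minus_minus)
  then have y2': "y2 = s + x2" by simp
  define q where "q = - x2 + x1"
  define r where "r = - x2 + s + x2"
  have "E (st wit True) = comm q r"
    unfolding 2 y1' y2' q_def r_def comm_def
    by (simp add: minus_add diff_plus add.assoc add_minus_cancels del: add_uminus_conv_diff)
  moreover have "q \<in> RR" "r \<in> RR"
    unfolding q_def r_def s_def by (intro RR_add RR_diff RR_uminus x1(1) x2(1) y1(1))+
  then obtain u v where "q = E u" "ki (kl u) = kk (kl u)" "r = E v" "ki (kl v) = kk (kl v)"
    unfolding RR_def by blast
  ultimately show False using wit_not_commutator by blast
qed

lemma gfun_image: "gfun ` {GA} = {gen_a}" "gfun ` UNIV = {gen_a, gen_b, gen_c, gen_d}"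
proof -
  have U: "(UNIV :: gen set) = {GA, GB, GC, GD}" using gen.exhaust by blast
  show "gfun ` UNIV = {gen_a, gen_b, gen_c, gen_d}" unfolding U by simp
qed simp

theorem corollaryB:
  shows "(\<forall>g \<in> derived grigorchuk (carrier grigorchuk).
            g \<in> products grigorchuk 6 (conjugates grigorchuk {gen_a})) \<and>
         (\<exists>g \<in> derived grigorchuk (carrier grigorchuk).
            g \<notin> products grigorchuk 4 (conjugates grigorchuk {gen_a})) \<and>
         (\<forall>g \<in> carrier grigorchuk. \<exists>n \<le> 8.
            g \<in> products grigorchuk n (conjugates grigorchuk {gen_a, gen_b, gen_c, gen_d}))"
proof (intro conjI ballI)
  fix g assume "g \<in> derived grigorchuk (carrier grigorchuk)"
  then obtain w where w: "g = Rep_tperm (E w)" "\<not> ci (cl w)" "\<not> cj (cl w)" "\<not> ck (cl w)"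
    using derived_word by blast
  show "g \<in> products grigorchuk 6 (conjugates grigorchuk {gen_a})"
    unfolding w(1) gfun_image(1)[symmetric] products_grigorchuk by (rule six_conjugates[OF w(2-4)])
next
  have "Rep_tperm (E wit) \<notin> products grigorchuk 4 (conjugates grigorchuk {gen_a})"
    unfolding gfun_image(1)[symmetric] products_grigorchuk using four_conjugates by blast
  then show "\<exists>g\<in>derived grigorchuk (carrier grigorchuk).
      g \<notin> products grigorchuk 4 (conjugates grigorchuk {gen_a})"
    using wit_derived by blast
next
  fix g assume "g \<in> carrier grigorchuk"
  then obtain w where w: "g = Rep_tperm (E w)" unfolding carrier_grigorchuk by blast
  show "\<exists>n\<le>8. g \<in> products grigorchuk n (conjugates grigorchuk {gen_a, gen_b, gen_c, gen_d})"
    unfolding w gfun_image(2)[symmetric] products_grigorchuk by (rule eight_conjugates)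
qed

end
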